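(* Let $\mathcal{A}$ be a generator of a one-dimensional diffusion process and let $\mathcal{D}(\mathcal{A})$ be its domain. Suppose $\mathcal{A}$ generates a Feller semigroup on $\mathcal{D}(\mathcal{A})$ and has unique stationary distribution $\mu$. Let $h(x)=x^k\in\mathcal{D}(\mathcal{A})$, where $k\in\{1,2,\ldots\}$, and suppose there exist constants $\{a_i\},\{b_i\}$ such that, for $f(x)=x^k$, $\mathcal{A}f(x)$ can be written as $$\mathcal{A}f(x)=\sum_{i=1}^k a_i\left[b_i x^{k-i}-x^k\right].$$ Then there exists a Markov jump process $Y_x(1,t)$ that is dual to $X_x(t)$, where $X_x(t)$ is a diffusion process with generator $\mathcal{A}$ and $X_x(0)=x$, such that the solution $f_h(x)$ to the Stein equation $\mathcal{A}f_h(x)=h(x)-\mathbb{E}h(Z)$ satisfies $$f_h(x)=-\int_0^\infty\left[\mathbb{E}\,Y_x(1,t)-\mathbb{E}h(Z)\right]dt,$$ where $Z\sim\mu$, and $Y_x(1,t)$ is a Markov jump process on functions of the form $g_x(a,k)=a x^k$, with $Y_x(1,0)=x^k$ and generator $$\mathcal{B}\,g_x(a,k)=\sum_{i=1}^k a_i\left[g_x(a b_i,\,k-i)-g_x(a,k)\right].$$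
   Context: The states of the jump process are monomial functions $g_x(a,k)=a x^k$, described by a coefficient $a$ and a degree $k$, with the point $x$ held fixed; the argument $1$ in $Y_x(1,t)$ is the coefficient of $x^k$ in the initial state. $\mathbb{E}\,Y_x(1,t)$ is the expectation, for fixed $x$, of the value at $x$ of the monomial occupied at time $t$. Duality of $Y_x(1,t)$ to $X_x(t)$ here means equality of the two semigroups: for $h(x)=x^k$, $\mathbb{E}h(X_x(t))=\mathbb{E}\,Y_x(1,t)$ for all $t>0$. The solution to the Stein equation is the one given by the semigroup of $\mathcal{A}$: $f_h(x)=-\int_0^\infty[\mathbb{E}h(X_x(t))-\mathbb{E}h(Z)]\,dt$.
   Formalization: The constants a_i, being the jump rates of B, are assumed nonnegative (with a negative a_i no jump process has generator B); x^j in D(A) and the formula for A x^j are assumed at every degree j = 1,...,k, with constants that may depend on j. *)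

theory Defs
  imports "HOL-Probability.Probability"
begin

definition transition_semigroup ::
    "'s measure \<Rightarrow> (real \<Rightarrow> 's \<Rightarrow> 's measure) \<Rightarrow> bool" where
  "transition_semigroup E P \<longleftrightarrow>
     (\<forall>t\<ge>0. P t \<in> E \<rightarrow>\<^sub>M prob_algebra E) \<and>
     (\<forall>x\<in>space E. P 0 x = return E x) \<and>
     (\<forall>s\<ge>0. \<forall>t\<ge>0. \<forall>x\<in>space E. P (s + t) x = P s x \<bind> P t)"

definition natural_filtration ::
    "'o measure \<Rightarrow> 's measure \<Rightarrow> (real \<Rightarrow> 'o \<Rightarrow> 's) \<Rightarrow> real \<Rightarrow> 'o measure" where
  "natural_filtration M E X s =
     sigma (space M) {X r -` C \<inter> space M | r C. 0 \<le> r \<and> r \<le> s \<and> C \<in> sets E}"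

definition markov_process ::
    "'o measure \<Rightarrow> 's measure \<Rightarrow> (real \<Rightarrow> 's \<Rightarrow> 's measure) \<Rightarrow> (real \<Rightarrow> 'o \<Rightarrow> 's) \<Rightarrow> bool" where
  "markov_process M E P X \<longleftrightarrow>
     prob_space M \<and>
     (\<forall>t\<ge>0. X t \<in> M \<rightarrow>\<^sub>M E) \<and>
     (\<forall>s\<ge>0. \<forall>t\<ge>0. \<forall>C\<in>sets E.
        AE \<omega> in M. real_cond_exp M (natural_filtration M E X s)
                      (\<lambda>\<omega>'. indicator C (X (s + t) \<omega>')) \<omega>
                  = measure (P t (X s \<omega>)) C)"

definition stationary_distribution ::
    "'s measure \<Rightarrow> (real \<Rightarrow> 's \<Rightarrow> 's measure) \<Rightarrow> 's measure \<Rightarrow> bool" where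
  "stationary_distribution E P \<mu> \<longleftrightarrow>
     \<mu> \<in> space (prob_algebra E) \<and> (\<forall>t\<ge>0. \<mu> \<bind> P t = \<mu>)"

definition unique_stationary_distribution ::
    "'s measure \<Rightarrow> (real \<Rightarrow> 's \<Rightarrow> 's measure) \<Rightarrow> 's measure \<Rightarrow> bool" where
  "unique_stationary_distribution E P \<mu> \<longleftrightarrow>
     stationary_distribution E P \<mu> \<and> (\<forall>\<nu>. stationary_distribution E P \<nu> \<longrightarrow> \<nu> = \<mu>)"

text \<open>
  With \<open>w = 1\<close>, \<open>weighted_C0 S w\<close> is the usual space of continuous functions on \<open>S\<close> vanishing at
  infinity with the supremum norm, and \<open>feller_semigroup\<close> and \<open>is_generator\<close> are the classical
  Feller semigroup and its infinitesimal generator. On an unbounded state space no monomial vanishes at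
  infinity, so a weight \<open>w\<close> is allowed: the norm is the supremum of \<open>\<bar>f x\<bar> / w x\<close>.
  For the Ornstein--Uhlenbeck process, for example, \<open>w x = 1 + x^(2 * m)\<close> puts all monomials of
  degree less than \<open>2 * m\<close> into the domain. Functions are total on the reals, but only their values
  on \<open>S\<close> matter.
\<close>

definition weighted_C0 :: "real set \<Rightarrow> (real \<Rightarrow> real) \<Rightarrow> (real \<Rightarrow> real) set" where
  "weighted_C0 S w =
     {f. continuous_on S f \<and>
         (\<forall>\<epsilon>>0. \<exists>K. compact K \<and> K \<subseteq> S \<and> (\<forall>x\<in>S - K. \<bar>f x\<bar> \<le> \<epsilon> * w x))}"

definition semigroup_op ::
    "(real \<Rightarrow> 's \<Rightarrow> 's measure) \<Rightarrow> real \<Rightarrow> ('s \<Rightarrow> real) \<Rightarrow> 's \<Rightarrow> real" where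
  "semigroup_op P t f x = (\<integral>y. f y \<partial>P t x)"

text \<open>
  The bound on the integrals of \<open>w\<close> says that the operators are bounded on the weighted space, uniformly
  for small times. For \<open>w = 1\<close> it holds with constant 1 (contractions).
\<close>

definition feller_semigroup ::
    "real set \<Rightarrow> (real \<Rightarrow> real) \<Rightarrow> (real \<Rightarrow> real \<Rightarrow> real measure) \<Rightarrow> bool" where
  "feller_semigroup S w P \<longleftrightarrow>
     continuous_on S w \<and> (\<forall>x\<in>S. 1 \<le> w x) \<and>
     transition_semigroup (restrict_space borel S) P \<and>
     (\<exists>C. \<forall>t\<in>{0..1}. \<forall>x\<in>S. (\<integral>\<^sup>+y. ennreal (w y) \<partial>P t x) \<le> ennreal (C * w x)) \<and>
     (\<forall>t\<ge>0. \<forall>f\<in>weighted_C0 S w. semigroup_op P t f \<in> weighted_C0 S w) \<and>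
     (\<forall>f\<in>weighted_C0 S w.
        uniform_limit S (\<lambda>t x. semigroup_op P t f x / w x) (\<lambda>x. f x / w x) (at_right 0))"

definition generator_graph ::
    "real set \<Rightarrow> (real \<Rightarrow> real) \<Rightarrow> (real \<Rightarrow> real \<Rightarrow> real measure) \<Rightarrow>
     (real \<Rightarrow> real) \<Rightarrow> (real \<Rightarrow> real) \<Rightarrow> bool" where
  "generator_graph S w P f g \<longleftrightarrow>
     f \<in> weighted_C0 S w \<and> g \<in> weighted_C0 S w \<and>
     uniform_limit S (\<lambda>t x. ((semigroup_op P t f x - f x) / t) / w x) (\<lambda>x. g x / w x) (at_right 0)"

definition is_generator ::
    "real set \<Rightarrow> (real \<Rightarrow> real) \<Rightarrow> (real \<Rightarrow> real \<Rightarrow> real measure) \<Rightarrow>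
     (real \<Rightarrow> real) set \<Rightarrow> ((real \<Rightarrow> real) \<Rightarrow> real \<Rightarrow> real) \<Rightarrow> bool" where
  "is_generator S w P D A \<longleftrightarrow>
     D = {f. \<exists>g. generator_graph S w P f g} \<and> (\<forall>f\<in>D. generator_graph S w P f (A f))"

definition diffusion_from ::
    "'o measure \<Rightarrow> real set \<Rightarrow> (real \<Rightarrow> real \<Rightarrow> real measure) \<Rightarrow> (real \<Rightarrow> 'o \<Rightarrow> real) \<Rightarrow> real \<Rightarrow> bool" where
  "diffusion_from M S P X x \<longleftrightarrow>
     markov_process M (restrict_space borel S) P X \<and>
     (AE \<omega> in M. X 0 \<omega> = x) \<and>
     (AE \<omega> in M. continuous_on {0..} (\<lambda>t. X t \<omega>))"

text \<open>
  \<open>c\<close> stands for the expectation of \<open>h\<close> under the stationary distribution. The Stein equation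
  determines \<open>f\<close> only up to the kernel of \<open>A\<close>; the last conjunct singles out the solution
  given by the semigroup.
\<close>

definition stein_solution ::
    "real set \<Rightarrow> (real \<Rightarrow> real) set \<Rightarrow> ((real \<Rightarrow> real) \<Rightarrow> real \<Rightarrow> real) \<Rightarrow>
     (real \<Rightarrow> 'o measure) \<Rightarrow> (real \<Rightarrow> real \<Rightarrow> 'o \<Rightarrow> real) \<Rightarrow>
     (real \<Rightarrow> real) \<Rightarrow> real \<Rightarrow> (real \<Rightarrow> real) \<Rightarrow> bool" where
  "stein_solution S D A M X h c f \<longleftrightarrow>
     f \<in> D \<and> (\<forall>x\<in>S. A f x = h x - c) \<and>
     (\<forall>x\<in>S. set_integrable lborel {0..} (\<lambda>t. (\<integral>\<omega>. h (X x t \<omega>) \<partial>M x) - c) \<and>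
            f x = - (LINT t:{0..}|lborel. (\<integral>\<omega>. h (X x t \<omega>) \<partial>M x) - c))"

text \<open>
  Right-continuity and existence of left limits are with respect to the discrete topology: paths
  are piecewise constant with finitely many jumps in bounded time. The operator \<open>B\<close> acts on all
  functions of the state, bounded or not.
\<close>

definition markov_jump_process ::
    "'o measure \<Rightarrow> 's set \<Rightarrow> (('s \<Rightarrow> real) \<Rightarrow> 's \<Rightarrow> real) \<Rightarrow> (real \<Rightarrow> 'o \<Rightarrow> 's) \<Rightarrow> bool" where
  "markov_jump_process M E B Y \<longleftrightarrow>
     (\<forall>\<omega>\<in>space M.
        (\<forall>t\<ge>0. \<forall>\<^sub>F s in at_right t. Y s \<omega> = Y t \<omega>) \<and>
        (\<forall>t>0. \<exists>z\<in>E. \<forall>\<^sub>F s in at_left t. Y s \<omega> = z)) \<and>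
     (\<exists>Q. transition_semigroup (count_space E) Q \<and>
          markov_process M (count_space E) Q Y \<and>
          (\<forall>\<phi>. \<forall>z\<in>E.
             (\<forall>t\<ge>0. integrable (Q t z) \<phi>) \<and>
             ((\<lambda>t. (semigroup_op Q t \<phi> z - \<phi> z) / t) \<longlongrightarrow> B \<phi> z) (at_right 0)))"

text \<open>The pair \<open>(c, j)\<close> encodes the monomial with coefficient \<open>c\<close> and degree \<open>j\<close>.\<close>

definition mono_states :: "nat \<Rightarrow> (real \<times> nat) set" where
  "mono_states k = {(c, j). j \<le> k}"

definition mono_val :: "real \<Rightarrow> real \<times> nat \<Rightarrow> real" where
  "mono_val x = (\<lambda>(c, j). c * x ^ j)"

text \<open>The rates and multipliers depend on the current degree \<open>j\<close> as well as on the drop \<open>i\<close>.\<close>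

definition dual_generator ::
    "(nat \<Rightarrow> nat \<Rightarrow> real) \<Rightarrow> (nat \<Rightarrow> nat \<Rightarrow> real) \<Rightarrow>
     (real \<times> nat \<Rightarrow> real) \<Rightarrow> real \<times> nat \<Rightarrow> real" where
  "dual_generator a b \<phi> = (\<lambda>(c, j). \<Sum>i=1..j. a j i * (\<phi> (c * b j i, j - i) - \<phi> (c, j)))"

end

theory Submission
  imports Defs
begin

text \<open>
  Every jump of the dual process lowers the degree, so its law can be built from one exponential
  holding time and one random drop per degree. Conditioning on the first jump, induction on the degree
  and the memoryless property give the Markov property; the same conditioning shows that the mean of
  any function along the process solves the backward equation, which for monomials is a triangular
  linear system of ODEs. On the diffusion side \<open>d/dt P\<^sub>t f = P\<^sub>t A f\<close> and the hypothesis on the action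
  of \<open>A\<close> give the same system for the moments, and uniqueness yields the duality. Substituting it into
  the semigroup solution of the Stein equation proves the claim.
\<close>

section \<open>Preliminaries on exponential and product measures\<close>

text \<open>Two features of the dual process shape the argument. From a fixed starting state only
  finitely many states can be reached, although coefficients range over all reals: degrees strictly
  drop, and each degree offers finitely many drops. Hence every real function is bounded along the
  process, and the dual generator can act on arbitrary functions without growth conditions. The
  multipliers \<open>b\<close> may have either sign; they only rescale the coefficient of the
  monomial and never enter a probability. On the diffusion side monomials are unbounded in general,
  so the equation for the moments has to be derived in the weighted norm, where the integrals of
  \<open>w\<close> control every error term. The two sides meet as functions of time only, with the
  point \<open>x\<close> frozen: the dual means start from \<open>x ^ j\<close> because they
  evaluate a monomial at \<open>x\<close>, the moments because the diffusion starts at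
  \<open>x\<close>.\<close>

lemma AE_exponential_pos:
  "AE y in density lborel (\<lambda>y. ennreal (exponential_density l y)). 0 < y"
proof -
  have "AE y in lborel. y \<noteq> (0::real)" by (rule AE_lborel_singleton)
  then show ?thesis
    by (subst AE_density) (auto simp: exponential_density_def elim: AE_mp)
qed

text \<open>Under the substitution \<open>y \<mapsto> s + y\<close> the density reproduces itself up
  to the factor \<open>exp (- l * s)\<close> at every positive \<open>y\<close>, so no integral has
  to be evaluated. The half-lines are open to match the strict positivity of the holding
  times.\<close>

lemma nn_integral_exponential_memoryless:
  fixes h :: "real \<Rightarrow> ennreal"
  assumes [measurable]: "h \<in> borel_measurable borel" and s: "0 \<le> s" 
  shows "(\<integral>\<^sup>+y. h (y - s) * indicator {s<..} y \<partial>density lborel (\<lambda>y. ennreal (exponential_density l y)))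
    = ennreal (exp (- l * s)) *
      (\<integral>\<^sup>+y. h y * indicator {0<..} y \<partial>density lborel (\<lambda>y. ennreal (exponential_density l y)))"
proof -
  have "(\<integral>\<^sup>+y. h (y - s) * indicator {s<..} y \<partial>density lborel (\<lambda>y. ennreal (exponential_density l y)))
      = (\<integral>\<^sup>+y. ennreal (exponential_density l y) * (h (y - s) * indicator {s<..} y) \<partial>lborel)"
    by (subst nn_integral_density) auto
  also have "\<dots> = (\<integral>\<^sup>+y. ennreal (exponential_density l (s + y)) * (h y * indicator {0<..} y) \<partial>lborel)"
    by (subst nn_integral_real_affine[where c=1 and t=s]) (auto intro!: nn_integral_cong simp: indicator_def)
  also have "\<dots> = (\<integral>\<^sup>+y. ennreal (exp (- l * s)) *
      (ennreal (exponential_density l y) * (h y * indicator {0<..} y)) \<partial>lborel)"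
  proof (intro nn_integral_cong)
    fix y :: real
    have "exponential_density l (s + y) = exp (- l * s) * exponential_density l y" if "0 < y"
      using that s by (simp add: exponential_density_def exp_add[symmetric] algebra_simps)
    then show "ennreal (exponential_density l (s + y)) * (h y * indicator {0<..} y) =
        ennreal (exp (- l * s)) * (ennreal (exponential_density l y) * (h y * indicator {0<..} y))"
      by (auto simp: indicator_def ennreal_mult' mult.assoc)
  qed
  also have "\<dots> = ennreal (exp (- l * s)) *
      (\<integral>\<^sup>+y. ennreal (exponential_density l y) * (h y * indicator {0<..} y) \<partial>lborel)"
    by (rule nn_integral_cmult) auto
  finally show ?thesis
    by (simp add: nn_integral_density)
qed

text \<open>Overwriting a coordinate by an independent sample of its own law preserves a product
  measure. The map that adjoins a coordinate \<open>n\<close> overwrites it here, because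
  \<open>insert n I = I\<close>. The inner integral is over the full product again, not over the
  product without \<open>n\<close>.\<close>

lemma nn_integral_PiM_resample:
  fixes f :: "('i \<Rightarrow> 'a) \<Rightarrow> ennreal"
  assumes M: "\<And>i. i \<in> I \<Longrightarrow> prob_space (M i)" and n: "n \<in> I"
    and f[measurable]: "f \<in> borel_measurable (Pi\<^sub>M I M)"
  shows "(\<integral>\<^sup>+\<omega>. f \<omega> \<partial>Pi\<^sub>M I M) = (\<integral>\<^sup>+y. \<integral>\<^sup>+\<omega>. f (\<omega> (n := y)) \<partial>Pi\<^sub>M I M \<partial>M n)"
proof -
  interpret P: prob_space "Pi\<^sub>M I M" using M by (rule prob_space_PiM)
  have I: "insert n I = I" using n by auto
  have m: "(\<lambda>(x, X). X(n := x)) \<in> measurable (M n \<Otimes>\<^sub>M Pi\<^sub>M I M) (Pi\<^sub>M I M)"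
    using measurable_add_dim[of n I M] by (subst (asm) measurable_pair_swap_iff) (simp add: I case_prod_beta')
  have "(\<integral>\<^sup>+\<omega>. f \<omega> \<partial>Pi\<^sub>M I M) = (\<integral>\<^sup>+\<omega>. f \<omega> \<partial>distr (M n \<Otimes>\<^sub>M Pi\<^sub>M I M) (Pi\<^sub>M I M) (\<lambda>(x, X). X(n := x)))"
    using distr_pair_PiM_eq_PiM[of I M n] M n by (simp add: I)
  also have "\<dots> = (\<integral>\<^sup>+p. f ((snd p)(n := fst p)) \<partial>(M n \<Otimes>\<^sub>M Pi\<^sub>M I M))"
    using m by (subst nn_integral_distr) (auto simp: case_prod_beta')
  also have "\<dots> = (\<integral>\<^sup>+y. \<integral>\<^sup>+\<omega>. f (\<omega> (n := y)) \<partial>Pi\<^sub>M I M \<partial>M n)"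
    using measurable_compose[OF m f] by (subst P.nn_integral_fst[symmetric]) (auto simp: case_prod_beta')
  finally show ?thesis .
qed

text \<open>The uniform bound supplies the integrability that Fubini requires for signed
  functions.\<close>

lemma integral_PiM_resample:
  fixes f :: "('i \<Rightarrow> 'a) \<Rightarrow> real"
  assumes M: "\<And>i. i \<in> I \<Longrightarrow> prob_space (M i)" and n: "n \<in> I"
    and f[measurable]: "f \<in> borel_measurable (Pi\<^sub>M I M)" and bd: "\<And>\<omega>. \<bar>f \<omega>\<bar> \<le> B"
  shows "(\<integral>\<omega>. f \<omega> \<partial>Pi\<^sub>M I M) = (\<integral>y. \<integral>\<omega>. f (\<omega> (n := y)) \<partial>Pi\<^sub>M I M \<partial>M n)"
proof -
  interpret P: prob_space "Pi\<^sub>M I M" using M by (rule prob_space_PiM)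
  interpret N: prob_space "M n" using M n by auto
  interpret Q: pair_prob_space "M n" "Pi\<^sub>M I M" ..
  have I: "insert n I = I" using n by auto
  have m: "(\<lambda>(x, X). X(n := x)) \<in> measurable (M n \<Otimes>\<^sub>M Pi\<^sub>M I M) (Pi\<^sub>M I M)"
    using measurable_add_dim[of n I M] by (subst (asm) measurable_pair_swap_iff) (simp add: I case_prod_beta')
  have "(\<integral>\<omega>. f \<omega> \<partial>Pi\<^sub>M I M) = (\<integral>\<omega>. f \<omega> \<partial>distr (M n \<Otimes>\<^sub>M Pi\<^sub>M I M) (Pi\<^sub>M I M) (\<lambda>(x, X). X(n := x)))"
    using distr_pair_PiM_eq_PiM[of I M n] M n by (simp add: I)
  also have "\<dots> = (\<integral>p. f ((snd p)(n := fst p)) \<partial>(M n \<Otimes>\<^sub>M Pi\<^sub>M I M))"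
    using m by (subst integral_distr) (auto simp: case_prod_beta')
  also have "\<dots> = (\<integral>y. \<integral>\<omega>. f (\<omega> (n := y)) \<partial>Pi\<^sub>M I M \<partial>M n)"
  proof -
    have "integrable (M n \<Otimes>\<^sub>M Pi\<^sub>M I M) (\<lambda>p. f ((snd p)(n := fst p)))"
      using measurable_compose[OF m f] bd
      by (intro Q.P.integrable_const_bound[where B=B]) (auto simp: case_prod_beta')
    then show ?thesis by (subst Q.integral_fst'[symmetric]) auto
  qed
  finally show ?thesis .
qed

section \<open>The dual jump process\<close>

locale dual_jump =
  fixes a b :: "nat \<Rightarrow> nat \<Rightarrow> real"
  assumes rate_nonneg: "0 \<le> a j i"
begin

definition total_rate :: "nat \<Rightarrow> real" where
  "total_rate j = (\<Sum>i=1..j. a j i)"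

definition drop_pmf :: "nat \<Rightarrow> nat pmf" where
  "drop_pmf j = embed_pmf (\<lambda>i. if i \<in> {1..j} then a j i / total_rate j else 0)"

text \<open>The rate 1 substituted for a vanishing total rate keeps this a probability measure, as
  the infinite product demands of every coordinate; \<open>drop_pmf\<close> is one by its
  type.\<close>

definition clock :: "nat \<Rightarrow> real measure" where
  "clock j = density lborel
     (\<lambda>y. ennreal (exponential_density (if 0 < total_rate j then total_rate j else 1) y))"

text \<open>
  Coordinate \<open>2 * j\<close> is the holding time at degree \<open>j\<close>, coordinate \<open>2 * j + 1\<close> the drop made there;
  since each degree is visited at most once, a single pair per degree is enough. If the total rate
  is 0, both laws are junk and never consulted.
\<close>

definition coord :: "nat \<Rightarrow> real measure" where
  "coord n = (if even n then clock (n div 2) else measure_pmf (map_pmf real (drop_pmf (n div 2))))"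

definition \<Omega> :: "(nat \<Rightarrow> real) measure" where
  "\<Omega> = Pi\<^sub>M UNIV coord"

definition jump :: "real \<times> nat \<Rightarrow> nat \<Rightarrow> real \<times> nat" where
  "jump z i = (fst z * b (snd z) i, snd z - i)"

text \<open>
  The guards fail only on null sets. They ensure that every single path, not just almost every one,
  starts in \<open>z\<close> and makes only admissible jumps.
\<close>

function path :: "real \<times> nat \<Rightarrow> (nat \<Rightarrow> real) \<Rightarrow> real \<Rightarrow> real \<times> nat" where
  "path (c, j) \<omega> t =
     (if 0 < total_rate j \<and> 0 < \<omega> (2 * j) \<and> \<omega> (2 * j) \<le> t \<and> nat \<lfloor>\<omega> (2 * j + 1)\<rfloor> \<in> {1..j}
      then path (jump (c, j) (nat \<lfloor>\<omega> (2 * j + 1)\<rfloor>)) \<omega> (t - \<omega> (2 * j))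
      else (c, j))"
  by pat_completeness auto
termination
  by (relation "Wellfounded.measure (\<lambda>(z, _, _). snd z)") (auto simp: jump_def)

declare path.simps[simp del]

lemma snd_jump [simp]: "snd (jump z i) = snd z - i"
  by (simp add: jump_def)

lemma pmf_drop:
  assumes "0 < total_rate j"
  shows "pmf (drop_pmf j) i = (if i \<in> {1..j} then a j i / total_rate j else 0)"
  unfolding drop_pmf_def
proof (rule pmf_embed_pmf)
  show "0 \<le> (if i \<in> {1..j} then a j i / total_rate j else 0)" for i
    using assms rate_nonneg by auto
  have "(\<integral>\<^sup>+i. ennreal (if i \<in> {1..j} then a j i / total_rate j else 0) \<partial>count_space UNIV)
      = (\<Sum>i\<in>{1..j}. ennreal (a j i / total_rate j))"
    by (subst nn_integral_count_space'[where A="{1..j}"]) auto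
  also have "\<dots> = ennreal (\<Sum>i\<in>{1..j}. a j i / total_rate j)"
    using assms rate_nonneg by (subst sum_ennreal) auto
  also have "(\<Sum>i\<in>{1..j}. a j i / total_rate j) = 1"
    using assms by (simp add: sum_divide_distrib[symmetric] total_rate_def)
  finally show "(\<integral>\<^sup>+i. ennreal (if i \<in> {1..j} then a j i / total_rate j else 0) \<partial>count_space UNIV) = 1"
    by simp
qed

lemma prob_space_clock: "prob_space (clock j)"
  unfolding clock_def by (rule prob_space_exponential_density) simp

lemma prob_space_coord: "prob_space (coord n)"
  by (simp add: coord_def prob_space_clock measure_pmf.prob_space_axioms)

lemma coord_even [simp]: "coord (2 * j) = clock j"
  and coord_odd [simp]: "coord (Suc (2 * j)) = measure_pmf (map_pmf real (drop_pmf j))"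
  by (simp_all add: coord_def)

lemma sets_clock [measurable_cong, simp]: "sets (clock j) = sets borel"
  by (simp add: clock_def)

lemma space_clock [simp]: "space (clock j) = UNIV"
  by (simp add: clock_def)

sublocale prob_space \<Omega>
  unfolding \<Omega>_def by (intro prob_space_PiM prob_space_coord)

lemma space_\<Omega> [simp]: "space \<Omega> = UNIV"
  by (auto simp: \<Omega>_def space_PiM coord_def PiE_def)

section \<open>Measurability of the paths and the coordinates they read\<close>

lemma measurable_clock_coord [measurable]: "(\<lambda>\<omega>. \<omega> (2 * j)) \<in> borel_measurable \<Omega>"
  unfolding \<Omega>_def using measurable_component_singleton[of "2 * j" UNIV coord]
  by (simp cong: measurable_cong_sets)

text \<open>Drops are stored as reals so that all coordinates share one type; taking
  \<open>nat\<close> of the floor decodes them. The coordinate carries the discrete sigma-algebra,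
  for which every function is measurable.\<close>

lemma measurable_drop_coord [measurable]:
  "(\<lambda>\<omega>. nat \<lfloor>\<omega> (Suc (2 * j))\<rfloor>) \<in> measurable \<Omega> (count_space UNIV)"
proof -
  have "(\<lambda>\<omega>. \<omega> (Suc (2 * j))) \<in> measurable \<Omega> (coord (Suc (2 * j)))"
    unfolding \<Omega>_def by (rule measurable_component_singleton) simp
  from measurable_compose[OF this, of "\<lambda>v. nat \<lfloor>v\<rfloor>" "count_space UNIV"] show ?thesis
    by simp
qed

text \<open>Measurability at each fixed time would not survive the recursion: the restarted path is
  evaluated at the random time \<open>t - \<omega> (2 * j)\<close>, so the induction needs joint
  measurability in path and time.\<close>

lemma measurable_path:
  "(\<lambda>(\<omega>, t). path (c, j) \<omega> t) \<in> measurable (\<Omega> \<Otimes>\<^sub>M borel) (count_space UNIV)"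
proof (induction j arbitrary: c rule: less_induct)
  case (less j)
  \<comment> \<open>Freezing the drop at \<open>i\<close> gives a restart of lower degree, covered
    by the induction hypothesis; the random drop is reinstated by a split into countably many
    cases.\<close>
  have step: "(\<lambda>p. if i \<in> {1..j} then path (jump (c, j) i) (fst p) (snd p - fst p (2 * j)) else (c, j))
      \<in> measurable (\<Omega> \<Otimes>\<^sub>M borel) (count_space UNIV)" for i
  proof (cases "i \<in> {1..j}")
    case True
    then have [measurable]: "(\<lambda>(\<omega>, t). path (jump (c, j) i) \<omega> t) \<in> measurable (\<Omega> \<Otimes>\<^sub>M borel) (count_space UNIV)"
      unfolding jump_def by (auto intro!: less)
    have "(\<lambda>p. (fst p, snd p - fst p (2 * j))) \<in> measurable (\<Omega> \<Otimes>\<^sub>M borel) (\<Omega> \<Otimes>\<^sub>M borel)"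
      by measurable
    from measurable_compose[OF this, of "\<lambda>(\<omega>, t). path (jump (c, j) i) \<omega> t" "count_space UNIV"]
    show ?thesis using True by simp
  next
    case False
    then show ?thesis by (simp only: if_False) simp
  qed
  have "(\<lambda>p. if nat \<lfloor>fst p (Suc (2 * j))\<rfloor> \<in> {1..j} then path (jump (c, j) (nat \<lfloor>fst p (Suc (2 * j))\<rfloor>))
          (fst p) (snd p - fst p (2 * j)) else (c, j)) \<in> measurable (\<Omega> \<Otimes>\<^sub>M borel) (count_space UNIV)"
    by (rule measurable_compose_countable[OF step]) measurable
  then have [measurable]: "(\<lambda>p. if 0 < total_rate j \<and> 0 < fst p (2 * j) \<and> fst p (2 * j) \<le> snd p then
      (if nat \<lfloor>fst p (Suc (2 * j))\<rfloor> \<in> {1..j} then path (jump (c, j) (nat \<lfloor>fst p (Suc (2 * j))\<rfloor>))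
          (fst p) (snd p - fst p (2 * j)) else (c, j)) else (c, j)) \<in> measurable (\<Omega> \<Otimes>\<^sub>M borel) (count_space UNIV)"
    by (rule measurable_If) measurable
  show ?case
    by (rule measurable_cong[THEN iffD1, rotated], fact)
       (auto simp: path.simps[of c j] case_prod_beta')
qed

lemma measurable_path_comp [measurable (raw)]:
  assumes "f \<in> measurable N \<Omega>" "g \<in> borel_measurable N"
  shows "(\<lambda>p. path z (f p) (g p)) \<in> measurable N (count_space UNIV)"
proof -
  have "(\<lambda>p. (f p, g p)) \<in> measurable N (\<Omega> \<Otimes>\<^sub>M borel)"
    using assms by measurable
  from measurable_compose[OF this measurable_path[of "fst z" "snd z"]] show ?thesis
    by simp
qed

text \<open>A path from degree \<open>j\<close> reads only coordinates of degrees at most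
  \<open>j\<close>. After a jump the degree is at most \<open>j - 1\<close>, so the coordinates
  \<open>2 * j\<close> and \<open>2 * j + 1\<close> are never read again.\<close>

lemma path_cong:
  assumes "\<And>n. n \<le> 2 * snd z + 1 \<Longrightarrow> \<omega> n = \<omega>' n"
  shows "path z \<omega> t = path z \<omega>' t"
  using assms
proof (induction z \<omega> t rule: path.induct)
  case (1 c j \<omega> t)
  have e: "\<omega> (2 * j) = \<omega>' (2 * j)" "\<omega> (2 * j + 1) = \<omega>' (2 * j + 1)"
    using 1(2) by auto
  show ?case
  proof (cases "0 < total_rate j \<and> 0 < \<omega> (2 * j) \<and> \<omega> (2 * j) \<le> t \<and> nat \<lfloor>\<omega> (2 * j + 1)\<rfloor> \<in> {1..j}")
    case True
    have "path (jump (c, j) (nat \<lfloor>\<omega> (2 * j + 1)\<rfloor>)) \<omega> (t - \<omega> (2 * j))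
        = path (jump (c, j) (nat \<lfloor>\<omega> (2 * j + 1)\<rfloor>)) \<omega>' (t - \<omega> (2 * j))"
      using 1(2) by (intro 1(1)[OF True]) auto
    then show ?thesis by (simp only: path.simps[of c j] e)
  next
    case False
    then show ?thesis by (simp only: path.simps[of c j] e simp_thms if_False)
  qed
qed

lemma path_no_rate: "\<not> 0 < total_rate (snd z) \<Longrightarrow> path z \<omega> t = z"
  by (cases z) (simp add: path.simps)

lemma path_nonpos: "t \<le> 0 \<Longrightarrow> path z \<omega> t = z"
  by (cases z, hypsubst, subst path.simps) auto

text \<open>The first jump becomes explicit, and its continuation may read the old
  \<open>\<omega>\<close>: by \<open>path_cong\<close> it does not see the two replaced
  coordinates.\<close>

lemma path_resampled:
  assumes "0 < total_rate (snd z)" "i \<in> {1..snd z}"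
  shows "path z (\<omega> (2 * snd z := y, Suc (2 * snd z) := real i)) t
       = (if 0 < y \<and> y \<le> t then path (jump z i) \<omega> (t - y) else z)"
proof -
  have "path (jump z i) (\<omega> (2 * snd z := y, Suc (2 * snd z) := real i)) (t - y) = path (jump z i) \<omega> (t - y)"
    using assms(2) by (intro path_cong) auto
  then show ?thesis
    using assms by (cases z) (auto simp: path.simps)
qed

section \<open>Range and regularity of single paths\<close>

lemma snd_path_le: "snd (path z \<omega> t) \<le> snd z"
proof (induction z \<omega> t rule: path.induct)
  case (1 c j \<omega> t)
  show ?case
    by (subst path.simps) (use 1 in \<open>auto simp del: atLeastAtMost_iff intro: order_trans\<close>)
qed

text \<open>Each jump lowers the degree and has at most \<open>snd z\<close> possible targets, so
  the tree of reachable states is finite. The set \<open>R\<close> depends on \<open>z\<close>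
  alone, which makes the bounds derived from it uniform in path and time.\<close>

lemma finite_path_range: "\<exists>R. finite R \<and> (\<forall>\<omega> t. path z \<omega> t \<in> R)"
proof (induction "snd z" arbitrary: z rule: less_induct)
  case (less z)
  have "\<exists>R. finite R \<and> (\<forall>\<omega> t. path (jump z i) \<omega> t \<in> R)" if "i \<in> {1..snd z}" for i
    using that by (intro less) auto
  then obtain R where R: "\<And>i. i \<in> {1..snd z} \<Longrightarrow> finite (R i)"
    "\<And>i \<omega> t. i \<in> {1..snd z} \<Longrightarrow> path (jump z i) \<omega> t \<in> R i"
    by metis
  have "path z \<omega> t \<in> insert z (\<Union>i\<in>{1..snd z}. R i)" for \<omega> t
  proof (cases "nat \<lfloor>\<omega> (2 * snd z + 1)\<rfloor> \<in> {1..snd z}")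
    case True
    have "path z \<omega> t = z \<or>
        path z \<omega> t = path (jump z (nat \<lfloor>\<omega> (2 * snd z + 1)\<rfloor>)) \<omega> (t - \<omega> (2 * snd z))"
      by (cases z) (auto simp: path.simps)
    with UN_I[of _ "{1..snd z}" _ R, OF True R(2)[OF True]] show ?thesis
      by (metis insertCI)
  next
    case False
    then show ?thesis by (cases z) (auto simp: path.simps)
  qed
  with R(1) show ?case by (intro exI[of _ "insert z (\<Union>i\<in>{1..snd z}. R i)"]) auto
qed

lemma path_bounded:
  fixes \<phi> :: "real \<times> nat \<Rightarrow> real"
  obtains B where "\<And>\<omega> t. \<bar>\<phi> (path z \<omega> t)\<bar> \<le> B" "0 \<le> B"
proof -
  obtain R where R: "finite R" "\<And>\<omega> t. path z \<omega> t \<in> R"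
    using finite_path_range by blast
  have "\<bar>\<phi> (path z \<omega> t)\<bar> \<le> (\<Sum>y\<in>R. \<bar>\<phi> y\<bar>)" for \<omega> t
    using R by (intro member_le_sum) auto
  then show ?thesis by (rule that) (simp add: sum_nonneg)
qed

lemma integrable_path: "integrable \<Omega> (\<lambda>\<omega>. \<phi> (path z \<omega> t) :: real)"
proof -
  obtain B where "\<And>\<omega> t. \<bar>\<phi> (path z \<omega> t)\<bar> \<le> B" using path_bounded[of \<phi> z] by blast
  then show ?thesis
    by (intro integrable_const_bound[where B=B]
        measurable_compose[of "\<lambda>\<omega>. path z \<omega> t" _ "count_space UNIV" \<phi>]) auto
qed

text \<open>The recursion jumps when \<open>\<omega> (2 * j) \<le> t\<close>, equality included; a
  path therefore has its new value already at the jump time.\<close>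

lemma path_right_continuous: "0 \<le> t \<Longrightarrow> \<forall>\<^sub>F s in at_right t. path z \<omega> s = path z \<omega> t"
proof (induction z \<omega> t rule: path.induct)
  case (1 c j \<omega> t)
  let ?i = "nat \<lfloor>\<omega> (2 * j + 1)\<rfloor>" and ?T = "\<omega> (2 * j)"
  show ?case
  proof (cases "0 < total_rate j \<and> 0 < ?T \<and> ?i \<in> {1..j}")
    case False
    then have "path (c, j) \<omega> s = (c, j)" for s by (auto simp: path.simps)
    then show ?thesis by simp
  next
    case True
    show ?thesis
    proof (cases "?T \<le> t")
      case le: True
      have "\<forall>\<^sub>F s in at_right (t - ?T). path (jump (c, j) ?i) \<omega> s = path (jump (c, j) ?i) \<omega> (t - ?T)"
        using True le by (intro 1) auto
      then have "\<forall>\<^sub>F s in at_right t. path (jump (c, j) ?i) \<omega> (s - ?T) = path (jump (c, j) ?i) \<omega> (t - ?T)"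
        by (auto simp: eventually_at_right_field) (metis add_less_cancel_right diff_add_cancel less_diff_eq)
      then show ?thesis
        using eventually_at_right_less[of t]
        by eventually_elim (use True le in \<open>auto simp: path.simps[of c j]\<close>)
    next
      case False
      then have "\<forall>\<^sub>F s in at_right t. s < ?T"
        by (auto simp: eventually_at_right_field intro: exI[of _ "\<omega> (2 * j)"])
      then show ?thesis
        by eventually_elim (use False in \<open>auto simp: path.simps[of c j]\<close>)
    qed
  qed
qed

lemma path_left_limit:
  "0 < t \<Longrightarrow> \<exists>z'. snd z' \<le> snd z \<and> (\<forall>\<^sub>F s in at_left t. path z \<omega> s = z')"
proof (induction z \<omega> t rule: path.induct)
  case (1 c j \<omega> t)
  let ?i = "nat \<lfloor>\<omega> (2 * j + 1)\<rfloor>" and ?T = "\<omega> (2 * j)"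
  show ?case
  proof (cases "0 < total_rate j \<and> 0 < ?T \<and> ?i \<in> {1..j}")
    case False
    then have "path (c, j) \<omega> s = (c, j)" for s by (auto simp: path.simps)
    then show ?thesis by auto
  next
    case True
    show ?thesis
    proof (cases "?T < t")
      case le: True
      have "\<exists>z'. snd z' \<le> snd (jump (c, j) ?i) \<and> (\<forall>\<^sub>F s in at_left (t - ?T). path (jump (c, j) ?i) \<omega> s = z')"
        using True le by (intro 1) auto
      then obtain z' where z': "snd z' \<le> j - ?i" "\<forall>\<^sub>F s in at_left (t - ?T). path (jump (c, j) ?i) \<omega> s = z'"
        by auto
      then have "\<forall>\<^sub>F s in at_left t. path (jump (c, j) ?i) \<omega> (s - ?T) = z'"
        by (auto simp: eventually_at_left_field) (metis add_less_cancel_right diff_add_cancel diff_less_eq)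
      moreover have "\<forall>\<^sub>F s in at_left t. ?T < s"
        using le by (auto simp: eventually_at_left_field)
      ultimately have "\<forall>\<^sub>F s in at_left t. path (c, j) \<omega> s = z'"
        by eventually_elim (use True in \<open>auto simp: path.simps[of c j]\<close>)
      with z'(1) show ?thesis by (intro exI[of _ z']) auto
    next
      case False
      \<comment> \<open>Here \<open>t \<le> \<omega> (2 * j)\<close>: all earlier times precede the
        jump, so even at the jump time itself the left limit is the old state.\<close>
      have "\<forall>\<^sub>F s in at_left t. s < t"
        by (auto simp: eventually_at_left_field intro: exI[of _ "t - 1"])
      then have "\<forall>\<^sub>F s in at_left t. path (c, j) \<omega> s = (c, j)"
        by eventually_elim (use False in \<open>auto simp: path.simps[of c j]\<close>)
      then show ?thesis by (intro exI[of _ "(c, j)"]) auto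
    qed
  qed
qed

section \<open>Conditioning on the first jump\<close>

lemma \<Omega>_resample: "f \<in> borel_measurable \<Omega> \<Longrightarrow>
    (\<integral>\<^sup>+\<omega>. f \<omega> \<partial>\<Omega>) = (\<integral>\<^sup>+y. \<integral>\<^sup>+\<omega>. f (\<omega> (n := y)) \<partial>\<Omega> \<partial>coord n)"
  unfolding \<Omega>_def by (rule nn_integral_PiM_resample) (auto intro: prob_space_coord)

lemma measurable_update_clock [measurable]:
  "(\<lambda>p. (snd p) (2 * j := fst p)) \<in> measurable (borel \<Otimes>\<^sub>M \<Omega>) \<Omega>"
proof -
  have "(\<lambda>p. (snd p) (2 * j := fst p)) \<in> measurable (coord (2 * j) \<Otimes>\<^sub>M \<Omega>) \<Omega>"
    unfolding \<Omega>_def using measurable_add_dim[of "2 * j" UNIV coord]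
    by (subst (asm) measurable_pair_swap_iff) (simp add: case_prod_beta')
  then show ?thesis
    by (simp cong: measurable_cong_sets)
qed

lemma measurable_update_clock' [measurable]: "(\<lambda>\<omega>. \<omega> (2 * j := y)) \<in> measurable \<Omega> \<Omega>"
  using measurable_compose[OF _ measurable_update_clock[of j], of "\<lambda>\<omega>. (y, \<omega>)" \<Omega>] by simp

lemma measurable_update_drop [measurable]: "(\<lambda>\<omega>. \<omega> (Suc (2 * j) := v)) \<in> measurable \<Omega> \<Omega>"
proof -
  have 1: "(\<lambda>p. (snd p) (Suc (2 * j) := fst p)) \<in> measurable (coord (Suc (2 * j)) \<Otimes>\<^sub>M \<Omega>) \<Omega>"
    unfolding \<Omega>_def using measurable_add_dim[of "Suc (2 * j)" UNIV coord]
    by (subst (asm) measurable_pair_swap_iff) (simp add: case_prod_beta')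
  have "(\<lambda>\<omega>. (v, \<omega>)) \<in> measurable \<Omega> (coord (Suc (2 * j)) \<Otimes>\<^sub>M \<Omega>)"
    by simp
  from measurable_compose[OF this 1] show ?thesis by simp
qed

lemma nn_integral_drop:
  assumes "0 < total_rate j"
  shows "(\<integral>\<^sup>+v. f v \<partial>coord (Suc (2 * j))) = (\<Sum>i=1..j. ennreal (a j i / total_rate j) * f (real i))"
proof -
  have "(\<integral>\<^sup>+v. f v \<partial>coord (Suc (2 * j))) = (\<integral>\<^sup>+i. f (real i) \<partial>drop_pmf j)"
    by simp
  also have "\<dots> = (\<Sum>i=1..j. f (real i) * ennreal (pmf (drop_pmf j) i))"
    using assms by (intro nn_integral_measure_pmf_support) (auto simp: pmf_drop set_pmf_iff)
  finally show ?thesis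
    using assms by (simp add: pmf_drop mult.commute)
qed

text \<open>The two coordinates of degree \<open>j\<close> are resampled rather than integrated out.
  The remaining integral is thus over all of \<open>\<Omega>\<close>, and facts about paths of lower
  degree apply to it unchanged.\<close>

lemma nn_integral_first_jump:
  assumes L: "0 < total_rate j" and f[measurable]: "f \<in> borel_measurable \<Omega>"
  shows "(\<integral>\<^sup>+\<omega>. f \<omega> \<partial>\<Omega>) = (\<integral>\<^sup>+y. (\<Sum>i=1..j. ennreal (a j i / total_rate j) *
      (\<integral>\<^sup>+\<omega>. f (\<omega> (2 * j := y, Suc (2 * j) := real i)) \<partial>\<Omega>)) \<partial>clock j)"
proof -
  have "(\<integral>\<^sup>+\<omega>. f \<omega> \<partial>\<Omega>) = (\<integral>\<^sup>+y. \<integral>\<^sup>+\<omega>. f (\<omega> (2 * j := y)) \<partial>\<Omega> \<partial>clock j)"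
    by (subst \<Omega>_resample[where n="2 * j"]) simp_all
  also have "\<dots> = (\<integral>\<^sup>+y. \<integral>\<^sup>+v. \<integral>\<^sup>+\<omega>. f (\<omega> (Suc (2 * j) := v, 2 * j := y)) \<partial>\<Omega> \<partial>coord (Suc (2 * j)) \<partial>clock j)"
    by (subst \<Omega>_resample[where n="Suc (2 * j)"]) simp_all
  finally show ?thesis
    using L by (simp add: nn_integral_drop fun_upd_twist del: coord_odd)
qed

lemma integral_first_jump:
  fixes f :: "(nat \<Rightarrow> real) \<Rightarrow> real"
  assumes L: "0 < total_rate j" and f[measurable]: "f \<in> borel_measurable \<Omega>" and bd: "\<And>\<omega>. \<bar>f \<omega>\<bar> \<le> B"
  shows "(\<integral>\<omega>. f \<omega> \<partial>\<Omega>) = (\<integral>y. (\<Sum>i=1..j. a j i / total_rate j *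
      (\<integral>\<omega>. f (\<omega> (2 * j := y, Suc (2 * j) := real i)) \<partial>\<Omega>)) \<partial>clock j)"
proof -
  have R: "(\<integral>\<omega>. g \<omega> \<partial>\<Omega>) = (\<integral>y. \<integral>\<omega>. g (\<omega> (n := y)) \<partial>\<Omega> \<partial>coord n)"
    if "g \<in> borel_measurable \<Omega>" "\<And>\<omega>. \<bar>g \<omega>\<bar> \<le> B" for g :: "(nat \<Rightarrow> real) \<Rightarrow> real" and n
    using that unfolding \<Omega>_def by (rule integral_PiM_resample[rotated 2]) (auto intro: prob_space_coord)
  have D: "(\<integral>v. g v \<partial>coord (Suc (2 * j))) = (\<Sum>i=1..j. a j i / total_rate j * g (real i))"
    for g :: "real \<Rightarrow> real"
  proof -
    have "(\<integral>v. g v \<partial>coord (Suc (2 * j))) = (\<integral>i. g (real i) \<partial>drop_pmf j)"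
      by simp
    also have "\<dots> = (\<Sum>i=1..j. g (real i) * pmf (drop_pmf j) i)"
      using L by (intro integral_measure_pmf_real) (auto simp: pmf_drop set_pmf_iff split: if_splits)
    finally show ?thesis using L by (simp add: pmf_drop mult.commute)
  qed
  have "(\<integral>\<omega>. f \<omega> \<partial>\<Omega>) = (\<integral>y. \<integral>\<omega>. f (\<omega> (2 * j := y)) \<partial>\<Omega> \<partial>clock j)"
    using R[of f "2 * j"] by (simp add: bd)
  also have "\<dots> = (\<integral>y. \<integral>v. \<integral>\<omega>. f (\<omega> (Suc (2 * j) := v, 2 * j := y)) \<partial>\<Omega> \<partial>coord (Suc (2 * j)) \<partial>clock j)"
    by (subst R[of _ "Suc (2 * j)"]) (simp_all add: bd)
  finally show ?thesis
    by (simp add: D fun_upd_twist del: coord_odd)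
qed

lemma AE_clock_pos: "AE y in clock j. 0 < y"
  unfolding clock_def by (rule AE_exponential_pos)

text \<open>
  Induction on the degree. If the first jump happens before \<open>s\<close>, the induction hypothesis applies to
  the path restarted there; otherwise the event is trivial and the claim is the memoryless property.
\<close>

lemma path_markov_property:
  fixes g :: "real \<times> nat \<Rightarrow> ennreal"
  assumes "finite R" "R \<subseteq> {0..s}" "0 \<le> s" "0 \<le> t"
  shows "(\<integral>\<^sup>+\<omega>. (if \<forall>r\<in>R. path z \<omega> r \<in> C r then g (path z \<omega> (s + t)) else 0) \<partial>\<Omega>) =
         (\<integral>\<^sup>+\<omega>. (if \<forall>r\<in>R. path z \<omega> r \<in> C r then \<integral>\<^sup>+\<omega>'. g (path (path z \<omega> s) \<omega>' t) \<partial>\<Omega> else 0) \<partial>\<Omega>)"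
  using assms(1-3)
proof (induction "snd z" arbitrary: z R C s rule: less_induct)
  case less
  note [measurable] = \<open>finite R\<close>
  define j where "j = snd z"
  define G where "G = (\<lambda>z. \<integral>\<^sup>+\<omega>'. g (path z \<omega>' t) \<partial>\<Omega>)"
  have [measurable]: "g \<in> measurable (count_space UNIV) borel" "G \<in> measurable (count_space UNIV) borel"
    by simp_all
  have [measurable]: "Measurable.pred (count_space UNIV) (\<lambda>y. y \<in> C r)" for r
    by simp
  show ?case
  proof (cases "0 < total_rate j")
    case False
    then have "path z \<omega> r = z" for \<omega> r
      unfolding j_def by (rule path_no_rate)
    then show ?thesis by (simp add: emeasure_space_1[simplified] cong: if_cong)
  next
    case True
    define p where "p = (\<lambda>i. ennreal (a j i / total_rate j))"
    \<comment> \<open>\<open>Y i y \<omega>\<close> is the path with first holding time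
      \<open>y\<close> and first drop \<open>i\<close>; \<open>U\<close> and \<open>V\<close> are
      the two sides of the claim conditioned on these, and \<open>H y\<close> is the mean of
      \<open>g\<close> at time \<open>t\<close> given holding time \<open>y\<close>.\<close>
    define Y where "Y = (\<lambda>i y \<omega> r. if 0 < y \<and> y \<le> r then path (jump z i) \<omega> (r - y) else z)"
    define U where "U = (\<lambda>i y. \<integral>\<^sup>+\<omega>. (if \<forall>r\<in>R. Y i y \<omega> r \<in> C r then g (Y i y \<omega> (s + t)) else 0) \<partial>\<Omega>)"
    define V where "V = (\<lambda>i y. \<integral>\<^sup>+\<omega>. (if \<forall>r\<in>R. Y i y \<omega> r \<in> C r then G (Y i y \<omega> s) else 0) \<partial>\<Omega>)"
    define H where "H = (\<lambda>y. \<Sum>i=1..j. p i * (\<integral>\<^sup>+\<omega>. g (Y i y \<omega> t) \<partial>\<Omega>))"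
    have [measurable]: "(\<lambda>p. Y i (fst p) (snd p) r) \<in> measurable (borel \<Otimes>\<^sub>M \<Omega>) (count_space UNIV)" for i r
      unfolding Y_def by measurable
    have [measurable]: "(\<lambda>y. U i y) \<in> borel_measurable borel" "(\<lambda>y. V i y) \<in> borel_measurable borel"
      "H \<in> borel_measurable borel" for i
      unfolding U_def V_def H_def by measurable
    have Yj: "path z (\<omega> (2 * j := y, Suc (2 * j) := real i)) r = Y i y \<omega> r" if "i \<in> {1..j}" for \<omega> y i r
      using path_resampled[of z i] that True by (simp add: j_def Y_def)
    have lhs: "(\<integral>\<^sup>+\<omega>. (if \<forall>r\<in>R. path z \<omega> r \<in> C r then g (path z \<omega> (s + t)) else 0) \<partial>\<Omega>)
        = (\<integral>\<^sup>+y. (\<Sum>i=1..j. p i * U i y) \<partial>clock j)"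
      using True by (subst nn_integral_first_jump[of j])
        (auto simp: p_def U_def Yj intro!: nn_integral_cong sum.cong cong: if_cong)
    have rhs: "(\<integral>\<^sup>+\<omega>. (if \<forall>r\<in>R. path z \<omega> r \<in> C r then G (path z \<omega> s) else 0) \<partial>\<Omega>)
        = (\<integral>\<^sup>+y. (\<Sum>i=1..j. p i * V i y) \<partial>clock j)"
      using True by (subst nn_integral_first_jump[of j])
        (auto simp: p_def V_def Yj intro!: nn_integral_cong sum.cong cong: if_cong)
    have Gz: "G z = (\<integral>\<^sup>+y. H y \<partial>clock j)"
      unfolding G_def using True by (subst nn_integral_first_jump[of j])
        (auto simp: p_def H_def Yj intro!: nn_integral_cong sum.cong cong: if_cong)
    have early: "U i y = V i y" if y: "0 < y" "y \<le> s" and i: "i \<in> {1..j}" for i y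
    \<comment> \<open>An observation strictly before the jump sees \<open>z\<close>. If one fails
      there, both sides vanish; otherwise only the later observations matter, and shifted by
      \<open>y\<close> they constrain the restarted path.\<close>
    proof (cases "\<exists>r\<in>R. r < y \<and> z \<notin> C r")
      case True
      then have "\<not> (\<forall>r\<in>R. Y i y \<omega> r \<in> C r)" for \<omega>
        by (force simp: Y_def)
      then show ?thesis by (simp only: U_def V_def if_False)
    next
      case False
      define R' where "R' = (\<lambda>r. r - y) ` {r\<in>R. y \<le> r}"
      have F: "(\<forall>r\<in>R. Y i y \<omega> r \<in> C r) \<longleftrightarrow> (\<forall>r\<in>R'. path (jump z i) \<omega> r \<in> C (r + y))" for \<omega>
        using False y by (auto simp: R'_def Y_def)
      have "finite R'" "R' \<subseteq> {0..s - y}" "0 \<le> s - y"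
        using less.prems y by (auto simp: R'_def)
      moreover have "snd (jump z i) < snd z"
        using i by (auto simp: j_def)
      ultimately have "(\<integral>\<^sup>+\<omega>. (if \<forall>r\<in>R'. path (jump z i) \<omega> r \<in> C (r + y)
            then g (path (jump z i) \<omega> (s - y + t)) else 0) \<partial>\<Omega>) =
          (\<integral>\<^sup>+\<omega>. (if \<forall>r\<in>R'. path (jump z i) \<omega> r \<in> C (r + y)
            then \<integral>\<^sup>+\<omega>'. g (path (path (jump z i) \<omega> (s - y)) \<omega>' t) \<partial>\<Omega> else 0) \<partial>\<Omega>)"
        by (intro less.hyps)
      moreover have "Y i y \<omega> s = path (jump z i) \<omega> (s - y)"
        "Y i y \<omega> (s + t) = path (jump z i) \<omega> (s - y + t)" for \<omega>
        using y \<open>0 \<le> t\<close> by (auto simp: Y_def algebra_simps)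
      ultimately show ?thesis
        by (simp only: U_def V_def F G_def)
    qed
    define K where "K = (\<forall>r\<in>R. z \<in> C r)"
    \<comment> \<open>If the clock rings after \<open>s\<close>, all observations up to
      \<open>s\<close> see \<open>z\<close>, so the event reduces to \<open>K\<close>, and the
      holding time remaining at \<open>s\<close> is \<open>y - s\<close>.\<close>
    have late: "(\<Sum>i=1..j. p i * U i y) = (if K then H (y - s) else 0)"
      "(\<Sum>i=1..j. p i * V i y) = (if K then G z else 0)" if y: "s < y" for y
    proof -
      have Yz: "Y i y \<omega> r = z" if "r \<le> s" for i \<omega> r
        using that y by (auto simp: Y_def)
      have F: "(\<forall>r\<in>R. Y i y \<omega> r \<in> C r) \<longleftrightarrow> K" for i \<omega>
        using less.prems Yz unfolding K_def by (intro ball_cong) auto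
      have "Y i y \<omega> (s + t) = Y i (y - s) \<omega> t" for i \<omega>
        using y less.prems by (auto simp: Y_def algebra_simps)
      then show "(\<Sum>i=1..j. p i * U i y) = (if K then H (y - s) else 0)"
        by (cases K) (simp_all only: U_def H_def F if_True if_False, simp_all)
      have "(\<Sum>i=1..j. p i) = ennreal (\<Sum>i=1..j. a j i / total_rate j)"
        unfolding p_def using True rate_nonneg by (subst sum_ennreal) auto
      also have "(\<Sum>i=1..j. a j i / total_rate j) = 1"
        using True by (simp add: sum_divide_distrib[symmetric] total_rate_def)
      finally have "(\<Sum>i=1..j. p i) = 1" by simp
      then show "(\<Sum>i=1..j. p i * V i y) = (if K then G z else 0)"
        by (simp add: V_def F Yz emeasure_space_1[simplified] flip: sum_distrib_right cong: if_cong)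
    qed
    have lateU: "(\<Sum>i=1..j. p i * U i y) * indicator {s<..} y = (if K then H (y - s) else 0) * indicator {s<..} y" for y
      by (cases "s < y") (simp_all only: late, simp_all)
    have lateV: "(\<Sum>i=1..j. p i * V i y) * indicator {s<..} y = (if K then G z else 0) * indicator {s<..} y" for y
      by (cases "s < y") (simp_all only: late, simp_all)
    have split: "(\<integral>\<^sup>+y. f y \<partial>clock j) = (\<integral>\<^sup>+y. f y * indicator {0<..s} y \<partial>clock j) +
        (\<integral>\<^sup>+y. f y * indicator {s<..} y \<partial>clock j)" if [measurable]: "f \<in> borel_measurable borel" for f
    proof -
      have "(\<integral>\<^sup>+y. f y \<partial>clock j) = (\<integral>\<^sup>+y. f y * indicator {0<..s} y + f y * indicator {s<..} y \<partial>clock j)"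
        by (rule nn_integral_cong_AE) (use AE_clock_pos[of j] in eventually_elim, auto simp: indicator_def)
      also have "\<dots> = (\<integral>\<^sup>+y. f y * indicator {0<..s} y \<partial>clock j) + (\<integral>\<^sup>+y. f y * indicator {s<..} y \<partial>clock j)"
        using that by (intro nn_integral_add borel_measurable_times_ennreal borel_measurable_indicator)
          (simp_all cong: measurable_cong_sets)
      finally show ?thesis .
    qed
    have shift: "(\<integral>\<^sup>+y. h (y - s) * indicator {s<..} y \<partial>clock j) =
        ennreal (exp (- total_rate j * s)) * (\<integral>\<^sup>+y. h y \<partial>clock j)"
      if [measurable]: "h \<in> borel_measurable borel" for h
    proof -
      have "(\<integral>\<^sup>+y. h y * indicator {0<..} y \<partial>clock j) = (\<integral>\<^sup>+y. h y \<partial>clock j)"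
        by (rule nn_integral_cong_AE) (use AE_clock_pos[of j] in eventually_elim, auto simp: indicator_def)
      then show ?thesis
        using nn_integral_exponential_memoryless[of h s "total_rate j"] less.prems True
        by (simp add: clock_def)
    qed
    have "(\<integral>\<^sup>+y. (\<Sum>i=1..j. p i * U i y) * indicator {0<..s} y \<partial>clock j) =
        (\<integral>\<^sup>+y. (\<Sum>i=1..j. p i * V i y) * indicator {0<..s} y \<partial>clock j)"
      by (intro nn_integral_cong) (auto simp: indicator_def early)
    moreover have "(\<integral>\<^sup>+y. (\<Sum>i=1..j. p i * U i y) * indicator {s<..} y \<partial>clock j) =
        (\<integral>\<^sup>+y. (\<Sum>i=1..j. p i * V i y) * indicator {s<..} y \<partial>clock j)"
    proof -
      interpret C: prob_space "clock j" by (rule prob_space_clock)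
      have "(\<integral>\<^sup>+y. (\<Sum>i=1..j. p i * U i y) * indicator {s<..} y \<partial>clock j) =
          (\<integral>\<^sup>+y. (if K then H (y - s) else 0) * indicator {s<..} y \<partial>clock j)"
        by (simp only: lateU lateV)
      \<comment> \<open>If \<open>K\<close> holds, both sides equal
        \<open>exp (- total_rate j * s) * G z\<close> by \<open>shift\<close>: the residual holding
        time is distributed like a fresh one.\<close>
      also have "\<dots> = (\<integral>\<^sup>+y. (if K then G z else 0) * indicator {s<..} y \<partial>clock j)"
        using shift[of H] shift[of "\<lambda>_. G z"] by (simp add: Gz C.emeasure_space_1[simplified])
      also have "\<dots> = (\<integral>\<^sup>+y. (\<Sum>i=1..j. p i * V i y) * indicator {s<..} y \<partial>clock j)"
        by (simp only: lateU lateV)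
      finally show ?thesis .
    qed
    ultimately have "(\<integral>\<^sup>+y. (\<Sum>i=1..j. p i * U i y) \<partial>clock j) = (\<integral>\<^sup>+y. (\<Sum>i=1..j. p i * V i y) \<partial>clock j)"
      by (subst (1 2) split) (simp_all del: One_nat_def)
    then show ?thesis
      using lhs rhs[unfolded G_def] by (simp only:)
  qed
qed

section \<open>Transition kernels and the Markov property\<close>

definition transition :: "nat \<Rightarrow> real \<Rightarrow> real \<times> nat \<Rightarrow> (real \<times> nat) measure" where
  "transition k t z = distr \<Omega> (count_space (mono_states k)) (\<lambda>\<omega>. path z \<omega> t)"

lemma mono_states_iff: "z \<in> mono_states k \<longleftrightarrow> snd z \<le> k"
  by (cases z) (simp add: mono_states_def)

lemma path_in_mono_states: "z \<in> mono_states k \<Longrightarrow> path z \<omega> t \<in> mono_states k"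
  using snd_path_le[of z \<omega> t] by (auto simp: mono_states_iff)

lemma measurable_path_mono_states:
  assumes "z \<in> mono_states k"
  shows "(\<lambda>\<omega>. path z \<omega> t) \<in> measurable \<Omega> (count_space (mono_states k))"
proof (rule measurableI)
  fix C assume "C \<in> sets (count_space (mono_states k))"
  have "(\<lambda>\<omega>. path z \<omega> t) \<in> measurable \<Omega> (count_space UNIV)" by measurable
  from measurable_sets[OF this, of C] show "(\<lambda>\<omega>. path z \<omega> t) -` C \<inter> space \<Omega> \<in> sets \<Omega>"
    by simp
qed (use assms in \<open>simp add: path_in_mono_states\<close>)

lemma emeasure_transition:
  assumes "z \<in> mono_states k" "C \<subseteq> mono_states k"
  shows "emeasure (transition k t z) C = (\<integral>\<^sup>+\<omega>. indicator C (path z \<omega> t) \<partial>\<Omega>)"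
proof -
  have "(\<lambda>\<omega>. path z \<omega> t) \<in> measurable \<Omega> (count_space UNIV)" by measurable
  from measurable_sets[OF this, of C] have "(\<lambda>\<omega>. path z \<omega> t) -` C \<in> sets \<Omega>"
    by simp
  then have "emeasure \<Omega> ((\<lambda>\<omega>. path z \<omega> t) -` C) = (\<integral>\<^sup>+\<omega>. indicator C (path z \<omega> t) \<partial>\<Omega>)"
    using nn_integral_indicator[of "(\<lambda>\<omega>. path z \<omega> t) -` C" \<Omega>] by (simp add: indicator_vimage)
  then show ?thesis
    unfolding transition_def using assms by (subst emeasure_distr) (auto simp: measurable_path_mono_states)
qed

lemma prob_space_transition: "z \<in> mono_states k \<Longrightarrow> prob_space (transition k t z)"
  unfolding transition_def by (intro prob_space_distr measurable_path_mono_states)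

lemma measurable_transition:
  "transition k t \<in> measurable (count_space (mono_states k)) (prob_algebra (count_space (mono_states k)))"
  by (simp add: measurable_count_space_eq1 space_prob_algebra)
     (auto intro: prob_space_transition simp: transition_def[THEN arg_cong[where f=sets]])

lemma transition_semigroup_transition:
  "transition_semigroup (count_space (mono_states k)) (transition k)"
  unfolding transition_semigroup_def
proof (intro conjI allI impI ballI)
  fix t :: real
  show "transition k t \<in> measurable (count_space (mono_states k)) (prob_algebra (count_space (mono_states k)))"
    by (rule measurable_transition)
next
  fix z assume "z \<in> space (count_space (mono_states k))"
  then show "transition k 0 z = return (count_space (mono_states k)) z"
    by (simp add: transition_def path_nonpos distr_const)
next
  fix s t :: real and z
  assume st: "0 \<le> s" "0 \<le> t" and z: "z \<in> space (count_space (mono_states k))"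
  show "transition k (s + t) z = transition k s z \<bind> transition k t"
  proof (rule measure_eqI)
    have ne: "space (transition k s z) \<noteq> {}"
      using z by (auto simp: transition_def)
    have m: "transition k t \<in> measurable (transition k s z) (subprob_algebra (count_space (mono_states k)))"
      using measurable_prob_algebraD[OF measurable_transition[of k t]]
      by (simp add: transition_def[of k s z] del: measurable_count_space_eq1)
    show "sets (transition k (s + t) z) = sets (transition k s z \<bind> transition k t)"
      by (subst sets_bind[where N="count_space (mono_states k)", OF _ ne]) (simp_all add: transition_def)
    fix C assume "C \<in> sets (transition k (s + t) z)"
    then have C: "C \<subseteq> mono_states k" by (simp add: transition_def)
    have "emeasure (transition k s z \<bind> transition k t) C = (\<integral>\<^sup>+y. emeasure (transition k t y) C \<partial>transition k s z)"
      using C by (intro emeasure_bind[OF ne m]) simp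
    also have "\<dots> = (\<integral>\<^sup>+\<omega>. emeasure (transition k t (path z \<omega> s)) C \<partial>\<Omega>)"
      unfolding transition_def[of k s z] using z
      by (subst nn_integral_distr) (auto intro: measurable_path_mono_states)
    also have "\<dots> = (\<integral>\<^sup>+\<omega>. \<integral>\<^sup>+\<omega>'. indicator C (path (path z \<omega> s) \<omega>' t) \<partial>\<Omega> \<partial>\<Omega>)"
      using z C by (simp add: emeasure_transition path_in_mono_states)
    \<comment> \<open>The Markov property without observations, \<open>R = {}\<close>, is the
      Chapman-Kolmogorov equation.\<close>
    also have "\<dots> = (\<integral>\<^sup>+\<omega>. indicator C (path z \<omega> (s + t)) \<partial>\<Omega>)"
      using path_markov_property[of "{}" s t z undefined "indicator C"] st by simp
    also have "\<dots> = emeasure (transition k (s + t) z) C"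
      using z C by (simp add: emeasure_transition)
    finally show "emeasure (transition k (s + t) z) C = emeasure (transition k s z \<bind> transition k t) C" ..
  qed
qed

text \<open>A pi-lambda argument: both integrals are finite measures in \<open>A\<close>, and
  \<open>path_markov_property\<close> equates them on events observing finitely many times up to
  \<open>s\<close>, an intersection-stable generator. Membership in \<open>sets \<Omega>\<close>
  joins the induction because the density formulas \<open>e1\<close> and \<open>e2\<close> are
  available only for such events.\<close>

lemma natural_filtration_path:
  assumes z: "z \<in> mono_states k" and C: "C \<subseteq> mono_states k" and st: "0 \<le> s" "0 \<le> t"
    and A: "A \<in> sets (natural_filtration \<Omega> (count_space (mono_states k)) (\<lambda>t \<omega>. path z \<omega> t) s)"
  shows "A \<in> sets \<Omega> \<and> (\<integral>\<^sup>+\<omega>. indicator C (path z \<omega> (s + t)) * indicator A \<omega> \<partial>\<Omega>) =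
         (\<integral>\<^sup>+\<omega>. emeasure (transition k t (path z \<omega> s)) C * indicator A \<omega> \<partial>\<Omega>)"
proof -
  let ?E = "{B. \<exists>R D. finite R \<and> R \<subseteq> {0..s} \<and> B = {\<omega>. \<forall>r\<in>R. path z \<omega> r \<in> D r}}"
  define M1 where "M1 = density \<Omega> (\<lambda>\<omega>. indicator C (path z \<omega> (s + t)))"
  define M2 where "M2 = density \<Omega> (\<lambda>\<omega>. emeasure (transition k t (path z \<omega> s)) C)"
  have m1: "(\<lambda>\<omega>. indicator C (path z \<omega> (s + t)) :: ennreal) \<in> borel_measurable \<Omega>"
    by (rule measurable_compose[of "\<lambda>\<omega>. path z \<omega> (s + t)" _ "count_space UNIV"]) auto
  have m2: "(\<lambda>\<omega>. emeasure (transition k t (path z \<omega> s)) C) \<in> borel_measurable \<Omega>"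
    by (rule measurable_compose[of "\<lambda>\<omega>. path z \<omega> s" _ "count_space UNIV"]) auto
  note [measurable] = m1 m2
  have e1: "emeasure M1 B = (\<integral>\<^sup>+\<omega>. indicator C (path z \<omega> (s + t)) * indicator B \<omega> \<partial>\<Omega>)" if "B \<in> sets \<Omega>" for B
    using that m1 unfolding M1_def by (intro emeasure_density)
  have e2: "emeasure M2 B = (\<integral>\<^sup>+\<omega>. emeasure (transition k t (path z \<omega> s)) C * indicator B \<omega> \<partial>\<Omega>)" if "B \<in> sets \<Omega>" for B
    using that m2 unfolding M2_def by (intro emeasure_density)
  have "Int_stable ?E"
  proof (rule Int_stableI, clarify)
    fix R D R' D'
    assume "finite R" "R \<subseteq> {0..s}" "finite R'" "R' \<subseteq> {0..s}"
    then show "\<exists>R'' D''. finite R'' \<and> R'' \<subseteq> {0..s} \<and>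
        {\<omega>. \<forall>r\<in>R. path z \<omega> r \<in> D r} \<inter> {\<omega>. \<forall>r\<in>R'. path z \<omega> r \<in> D' r} = {\<omega>. \<forall>r\<in>R''. path z \<omega> r \<in> D'' r}"
      \<comment> \<open>A time observed by only one of the two events gets the void condition
        \<open>UNIV\<close> from the other.\<close>
      by (intro exI[of _ "R \<union> R'"] exI[of _ "\<lambda>r. (if r \<in> R then D r else UNIV) \<inter> (if r \<in> R' then D' r else UNIV)"])
         auto
  qed
  moreover have "?E \<subseteq> Pow UNIV" by simp
  moreover have "A \<in> sigma_sets UNIV ?E"
  proof -
    have "A \<in> sigma_sets UNIV {(\<lambda>\<omega>. path z \<omega> r) -` D \<inter> space \<Omega> | r D. 0 \<le> r \<and> r \<le> s \<and> D \<in> sets (count_space (mono_states k))}"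
      using A by (simp add: natural_filtration_def)
    moreover have "{(\<lambda>\<omega>. path z \<omega> r) -` D \<inter> space \<Omega> | r D. 0 \<le> r \<and> r \<le> s \<and> D \<in> sets (count_space (mono_states k))} \<subseteq> ?E"
    proof clarify
      fix r D assume "0 \<le> r" "r \<le> s"
      then show "\<exists>R D'. finite R \<and> R \<subseteq> {0..s} \<and> (\<lambda>\<omega>. path z \<omega> r) -` D \<inter> space \<Omega> = {\<omega>. \<forall>r\<in>R. path z \<omega> r \<in> D' r}"
        by (intro exI[of _ "{r}"] exI[of _ "\<lambda>_. D"]) auto
    qed
    ultimately show ?thesis by (meson sigma_sets_mono' subsetD)
  qed
  ultimately have "A \<in> sets \<Omega> \<and> emeasure M1 A = emeasure M2 A"
  proof (induction rule: sigma_sets_induct_disjoint)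
    case (basic B)
    then obtain R D where R: "finite R" "R \<subseteq> {0..s}" and B: "B = {\<omega>. \<forall>r\<in>R. path z \<omega> r \<in> D r}"
      by auto
    have "{\<omega>\<in>space \<Omega>. \<forall>r\<in>R. path z \<omega> r \<in> D r} \<in> sets \<Omega>"
    proof (intro sets.sets_Collect_finite_All R(1))
      fix r
      have "(\<lambda>\<omega>. path z \<omega> r) \<in> measurable \<Omega> (count_space UNIV)" by measurable
      from measurable_sets[OF this, of "D r"] show "{\<omega>\<in>space \<Omega>. path z \<omega> r \<in> D r} \<in> sets \<Omega>"
        by (simp add: vimage_def)
    qed
    then have Bs: "B \<in> sets \<Omega>" by (simp add: B)
    have "emeasure M1 B = (\<integral>\<^sup>+\<omega>. (if \<forall>r\<in>R. path z \<omega> r \<in> D r then indicator C (path z \<omega> (s + t)) else 0) \<partial>\<Omega>)"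
      unfolding e1[OF Bs] by (intro nn_integral_cong) (simp add: B indicator_def)
    also have "\<dots> = (\<integral>\<^sup>+\<omega>. (if \<forall>r\<in>R. path z \<omega> r \<in> D r then \<integral>\<^sup>+\<omega>'. indicator C (path (path z \<omega> s) \<omega>' t) \<partial>\<Omega> else 0) \<partial>\<Omega>)"
      by (rule path_markov_property[OF R st])
    also have "\<dots> = emeasure M2 B"
      unfolding e2[OF Bs] using z C
      by (intro nn_integral_cong) (simp add: B indicator_def[of B] emeasure_transition path_in_mono_states)
    finally show ?case using Bs by simp
  next
    case empty
    then show ?case by simp
  next
    case (compl B)
    have sp: "space M1 = UNIV" "space M2 = UNIV" "sets M1 = sets \<Omega>" "sets M2 = sets \<Omega>"
      by (simp_all add: M1_def M2_def)
    have U: "(UNIV :: (nat \<Rightarrow> real) set) \<in> sets \<Omega>" using sets.top[of \<Omega>] by simp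
    have tot: "emeasure M1 UNIV = emeasure M2 UNIV"
      unfolding e1[OF U] e2[OF U] using path_markov_property[of "{}" s t z undefined "indicator C"] st z C
      by (simp add: emeasure_transition path_in_mono_states)
    \<comment> \<open>Finiteness licenses the subtraction in the complement step.\<close>
    have fin: "emeasure M1 UNIV \<noteq> \<infinity>"
    proof -
      have "emeasure M1 UNIV \<le> (\<integral>\<^sup>+\<omega>. 1 \<partial>\<Omega>)"
        unfolding e1[OF U] by (intro nn_integral_mono) (simp add: indicator_def)
      then show ?thesis by (auto simp: emeasure_space_1[simplified] top_unique)
    qed
    have "emeasure M1 B \<noteq> \<infinity>"
      using emeasure_mono[of B UNIV M1] fin U sp by (auto simp: top_unique)
    then have "emeasure M1 (UNIV - B) = emeasure M2 (UNIV - B)"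
      using compl emeasure_compl[of B M1] emeasure_compl[of B M2] tot by (simp add: sp)
    then show ?case using compl U by auto
  next
    case (union B)
    then have "range B \<subseteq> sets M1" "range B \<subseteq> sets M2"
      by (auto simp: M1_def M2_def)
    then have "emeasure M1 (\<Union>i. B i) = emeasure M2 (\<Union>i. B i)"
      using union by (simp flip: suminf_emeasure)
    then show ?case using union by auto
  qed
  then show ?thesis using e1 e2 by auto
qed

text \<open>Integrals over filtration events determine a conditional expectation.
  \<open>natural_filtration_path\<close> provides them as nonnegative integrals, and
  \<open>enn2real\<close> carries them over to real ones.\<close>

lemma markov_process_path:
  assumes z: "z \<in> mono_states k"
  shows "markov_process \<Omega> (count_space (mono_states k)) (transition k) (\<lambda>t \<omega>. path z \<omega> t)"
  unfolding markov_process_def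
proof (intro conjI allI impI ballI)
  show "prob_space \<Omega>" by (rule prob_space_axioms)
  show "(\<lambda>\<omega>. path z \<omega> t) \<in> measurable \<Omega> (count_space (mono_states k))" for t
    using z by (rule measurable_path_mono_states)
next
  fix s t :: real and C
  assume st: "0 \<le> s" "0 \<le> t" and "C \<in> sets (count_space (mono_states k))"
  then have C: "C \<subseteq> mono_states k" by simp
  define F where "F = natural_filtration \<Omega> (count_space (mono_states k)) (\<lambda>t \<omega>. path z \<omega> t) s"
  note key = natural_filtration_path[OF z C st, folded F_def]
  have spF: "space F = space \<Omega>" by (simp add: F_def natural_filtration_def)
  interpret F: finite_measure_subalgebra \<Omega> F
    by unfold_locales (use key spF in \<open>auto simp: subalgebra_def\<close>)
  have m1: "(\<lambda>\<omega>. indicator C (path z \<omega> (s + t)) :: real) \<in> borel_measurable \<Omega>"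
    by (rule measurable_compose[of "\<lambda>\<omega>. path z \<omega> (s + t)" _ "count_space UNIV"]) auto
  have m2: "(\<lambda>\<omega>. measure (transition k t (path z \<omega> s)) C) \<in> borel_measurable \<Omega>"
    by (rule measurable_compose[of "\<lambda>\<omega>. path z \<omega> s" _ "count_space UNIV"]) auto
  have le1: "measure (transition k t (path z \<omega> s)) C \<le> 1" for \<omega>
    using prob_space_transition[OF path_in_mono_states[OF z], of t \<omega> s]
    by (simp add: prob_space.prob_le_1)
  show "AE \<omega> in \<Omega>. real_cond_exp \<Omega> (natural_filtration \<Omega> (count_space (mono_states k)) (\<lambda>t \<omega>. path z \<omega> t) s)
      (\<lambda>\<omega>'. indicator C (path z \<omega>' (s + t))) \<omega> = measure (transition k t (path z \<omega> s)) C"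
    unfolding F_def[symmetric]
  proof (rule F.real_cond_exp_charact)
    show "integrable \<Omega> (\<lambda>\<omega>. indicator C (path z \<omega> (s + t)) :: real)"
      using m1 by (intro integrable_const_bound[where B=1]) (auto simp: indicator_def)
    show "integrable \<Omega> (\<lambda>\<omega>. measure (transition k t (path z \<omega> s)) C)"
      using m2 le1 by (intro integrable_const_bound[where B=1]) auto
    have "(\<lambda>\<omega>. path z \<omega> s) \<in> measurable F (count_space (mono_states k))"
    proof (rule measurableI)
      fix D assume "D \<in> sets (count_space (mono_states k))"
      then show "(\<lambda>\<omega>. path z \<omega> s) -` D \<inter> space F \<in> sets F"
        using st unfolding spF unfolding F_def natural_filtration_def
        by (subst sets_measure_of) (auto intro!: sigma_sets.Basic)
    qed (use z in \<open>simp add: path_in_mono_states\<close>)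
    then show "(\<lambda>\<omega>. measure (transition k t (path z \<omega> s)) C) \<in> borel_measurable F"
      by (rule measurable_compose) simp
  next
    fix A assume A: "A \<in> sets F"
    then have [measurable]: "A \<in> sets \<Omega>" using key by auto
    have "(\<integral>\<omega>\<in>A. indicator C (path z \<omega> (s + t)) \<partial>\<Omega>) =
        enn2real (\<integral>\<^sup>+\<omega>. indicator C (path z \<omega> (s + t)) * indicator A \<omega> \<partial>\<Omega>)"
      unfolding set_lebesgue_integral_def using m1
      by (subst integral_eq_nn_integral)
         (auto intro!: arg_cong[where f=enn2real] nn_integral_cong simp: indicator_def)
    also have "\<dots> = enn2real (\<integral>\<^sup>+\<omega>. emeasure (transition k t (path z \<omega> s)) C * indicator A \<omega> \<partial>\<Omega>)"
      using key[OF A] by simp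
    also have "\<dots> = (\<integral>\<omega>\<in>A. measure (transition k t (path z \<omega> s)) C \<partial>\<Omega>)"
    proof -
      have "ennreal (measure (transition k t (path z \<omega> s)) C) = emeasure (transition k t (path z \<omega> s)) C" for \<omega>
        using prob_space_transition[OF path_in_mono_states[OF z], of t \<omega> s]
        by (simp add: finite_measure.emeasure_eq_measure prob_space.finite_measure)
      then show ?thesis
        unfolding set_lebesgue_integral_def using m2
        by (subst integral_eq_nn_integral)
           (auto intro!: arg_cong[where f=enn2real] nn_integral_cong simp: indicator_def)
    qed
    finally show "(\<integral>\<omega>\<in>A. indicator C (path z \<omega> (s + t)) \<partial>\<Omega>) = (\<integral>\<omega>\<in>A. measure (transition k t (path z \<omega> s)) C \<partial>\<Omega>)" .
  qed
qed

section \<open>Means along the path and the backward equation\<close>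

definition path_mean :: "(real \<times> nat \<Rightarrow> real) \<Rightarrow> real \<times> nat \<Rightarrow> real \<Rightarrow> real" where
  "path_mean \<phi> z t = (\<integral>\<omega>. \<phi> (path z \<omega> t) \<partial>\<Omega>)"

lemma path_mean_0 [simp]: "path_mean \<phi> z 0 = \<phi> z"
  by (simp add: path_mean_def path_nonpos prob_space[simplified])

lemma path_mean_no_rate: "\<not> 0 < total_rate (snd z) \<Longrightarrow> path_mean \<phi> z t = \<phi> z"
  by (simp add: path_mean_def path_no_rate prob_space[simplified])

lemma measurable_comp_path [measurable (raw)]:
  assumes "f \<in> measurable N \<Omega>" "g \<in> borel_measurable N"
  shows "(\<lambda>p. \<phi> (path z (f p) (g p)) :: real) \<in> borel_measurable N"
  by (rule measurable_compose[OF measurable_path_comp[OF assms]]) simp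

lemma measurable_path_mean [measurable]: "path_mean \<phi> z \<in> borel_measurable borel"
  unfolding path_mean_def by measurable

lemma path_mean_bounded: "\<exists>B. \<forall>t. \<bar>path_mean \<phi> z t\<bar> \<le> B"
proof -
  obtain B where B: "\<And>\<omega> t. \<bar>\<phi> (path z \<omega> t)\<bar> \<le> B"
    using path_bounded[of \<phi> z] by blast
  have "\<bar>path_mean \<phi> z t\<bar> \<le> B" for t
  proof -
    have "\<bar>path_mean \<phi> z t\<bar> \<le> (\<integral>\<omega>. \<bar>\<phi> (path z \<omega> t)\<bar> \<partial>\<Omega>)"
      unfolding path_mean_def by (rule integral_abs_bound)
    also have "\<dots> \<le> (\<integral>\<omega>. B \<partial>\<Omega>)"
      using B integrable_path[of "\<lambda>y. \<bar>\<phi> y\<bar>"] by (intro integral_mono) auto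
    finally show ?thesis by (simp add: prob_space[simplified])
  qed
  then show ?thesis by blast
qed

text \<open>This is the renewal equation. If no jump occurs up to \<open>t\<close>, the average over
  the drop collapses, since its weights add up to 1.\<close>

lemma path_mean_first_jump:
  assumes L: "0 < total_rate (snd z)"
  shows "path_mean \<phi> z t = (\<integral>y. (if 0 < y \<and> y \<le> t
     then (\<Sum>i=1..snd z. a (snd z) i * path_mean \<phi> (jump z i) (t - y)) / total_rate (snd z)
     else \<phi> z) \<partial>clock (snd z))"
proof -
  define j where "j = snd z"
  obtain B where B: "\<And>\<omega> t. \<bar>\<phi> (path z \<omega> t)\<bar> \<le> B"
    using path_bounded[of \<phi> z] by blast
  have 1: "(\<Sum>i=1..j. a j i / total_rate j) = 1"
    using L by (simp add: sum_divide_distrib[symmetric] total_rate_def j_def)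
  have average: "(\<Sum>i=1..j. a j i / total_rate j * (if c then u i else v)) =
      (if c then (\<Sum>i=1..j. a j i * u i) / total_rate j else v)" for c u v
    using 1 sum_distrib_right[of "\<lambda>i. a j i / total_rate j" "{1..j}" v]
    by (cases c) (simp_all add: sum_divide_distrib)
  have "path_mean \<phi> z t = (\<integral>y. (\<Sum>i=1..j. a j i / total_rate j *
      (\<integral>\<omega>. \<phi> (path z (\<omega> (2 * j := y, Suc (2 * j) := real i)) t) \<partial>\<Omega>)) \<partial>clock j)"
    unfolding path_mean_def using L B by (intro integral_first_jump) (auto simp: j_def)
  also have "\<dots> = (\<integral>y. (if 0 < y \<and> y \<le> t
     then (\<Sum>i=1..j. a j i * path_mean \<phi> (jump z i) (t - y)) / total_rate j else \<phi> z) \<partial>clock j)"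
  proof (intro Bochner_Integration.integral_cong refl)
    fix y
    have "(\<Sum>i=1..j. a j i / total_rate j * (\<integral>\<omega>. \<phi> (path z (\<omega> (2 * j := y, Suc (2 * j) := real i)) t) \<partial>\<Omega>))
      = (\<Sum>i=1..j. a j i / total_rate j * (if 0 < y \<and> y \<le> t then path_mean \<phi> (jump z i) (t - y) else \<phi> z))"
      using L by (intro sum.cong refl)
        (auto simp: j_def path_resampled path_mean_def prob_space[simplified])
    also have "\<dots> = (if 0 < y \<and> y \<le> t
      then (\<Sum>i=1..j. a j i * path_mean \<phi> (jump z i) (t - y)) / total_rate j else \<phi> z)"
      by (rule average)
    finally show "(\<Sum>i=1..j. a j i / total_rate j * (\<integral>\<omega>. \<phi> (path z (\<omega> (2 * j := y, Suc (2 * j) := real i)) t) \<partial>\<Omega>))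
      = (if 0 < y \<and> y \<le> t
      then (\<Sum>i=1..j. a j i * path_mean \<phi> (jump z i) (t - y)) / total_rate j else \<phi> z)" .
  qed
  finally show ?thesis by (simp only: j_def)
qed

text \<open>Memorylessness for the constant function 1 gives the tail at once, because the positive
  half-line has full mass.\<close>

lemma measure_clock_greaterThan:
  assumes "0 < total_rate j" "0 \<le> t"
  shows "measure (clock j) {t<..} = exp (- total_rate j * t)"
proof -
  interpret C: prob_space "clock j" by (rule prob_space_clock)
  have "emeasure (clock j) {0<..} = 1"
    using AE_clock_pos[of j] C.emeasure_eq_1_AE[of "{0<..}"] by simp
  then have "emeasure (clock j) {t<..} = ennreal (exp (- total_rate j * t))"
    using nn_integral_exponential_memoryless[of "\<lambda>_. 1" t "total_rate j"] assms
    by (simp add: clock_def)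
  then show ?thesis by (simp add: C.emeasure_eq_measure)
qed

text \<open>The substitution \<open>v = t - y\<close> in the renewal equation frees the integrand of
  \<open>t\<close> up to the factor \<open>exp (- total_rate (snd z) * t)\<close>. Then
  \<open>t\<close> survives only in that factor and in the upper limit, a form that the fundamental
  theorem of calculus can differentiate.\<close>

lemma path_mean_variation_of_constants:
  assumes L: "0 < total_rate (snd z)" and t: "0 \<le> t"
    and cont: "\<And>i. i \<in> {1..snd z} \<Longrightarrow> continuous_on {0..} (path_mean \<phi> (jump z i))"
  shows "path_mean \<phi> z t = exp (- total_rate (snd z) * t) * (\<phi> z + integral {0..t}
     (\<lambda>v. exp (total_rate (snd z) * v) * (\<Sum>i=1..snd z. a (snd z) i * path_mean \<phi> (jump z i) v)))"
proof -
  define j where "j = snd z"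
  define L where "L = total_rate j"
  define h where "h = (\<lambda>v. \<Sum>i=1..j. a j i * path_mean \<phi> (jump z i) v)"
  have L0: "0 < L" using L by (simp add: L_def j_def)
  have [measurable]: "h \<in> borel_measurable borel"
    unfolding h_def by measurable
  obtain B where B: "\<And>i v. \<bar>path_mean \<phi> (jump z i) v\<bar> \<le> B i"
  proof -
    have "\<forall>i. \<exists>B. \<forall>v. \<bar>path_mean \<phi> (jump z i) v\<bar> \<le> B"
      using path_mean_bounded by blast
    from choice[OF this] show thesis using that by blast
  qed
  have hB: "\<bar>h v\<bar> \<le> (\<Sum>i=1..j. a j i * B i)" for v
    unfolding h_def by (rule order_trans[OF sum_abs]) (auto intro!: sum_mono mult_left_mono B simp: abs_mult rate_nonneg)
  interpret C: prob_space "clock j" by (rule prob_space_clock)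
  have "path_mean \<phi> z t = (\<integral>y. (if 0 < y \<and> y \<le> t then h (t - y) / L else \<phi> z) \<partial>clock j)"
    unfolding h_def L_def j_def by (rule path_mean_first_jump[OF L])
  \<comment> \<open>The two integrands can differ only for \<open>y \<le> 0\<close>, a null set of
    the clock.\<close>
  also have "\<dots> = (\<integral>y. indicator {0..t} y * (h (t - y) / L) + indicator {t<..} y * \<phi> z \<partial>clock j)"
  proof (rule integral_cong_AE)
    show "AE y in clock j. (if 0 < y \<and> y \<le> t then h (t - y) / L else \<phi> z) =
        indicator {0..t} y * (h (t - y) / L) + indicator {t<..} y * \<phi> z"
      using AE_clock_pos[of j] by eventually_elim (auto simp: indicator_def)
  qed (simp_all cong: measurable_cong_sets)
  also have "\<dots> = (\<integral>y. indicator {0..t} y * (h (t - y) / L) \<partial>clock j) + (\<integral>y. indicator {t<..} y * \<phi> z \<partial>clock j)"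
  proof (rule Bochner_Integration.integral_add)
    have "(\<Sum>i=1..j. a j i * B i) \<ge> 0" using hB[of 0] by linarith
    then show "integrable (clock j) (\<lambda>y. indicator {0..t} y * (h (t - y) / L))"
      using hB L0 by (intro C.integrable_const_bound[where B="(\<Sum>i=1..j. a j i * B i) / L"])
        (auto simp: indicator_def divide_right_mono cong: measurable_cong_sets)
    show "integrable (clock j) (\<lambda>y. indicator {t<..} y * \<phi> z)"
      by (intro C.integrable_const_bound[where B="\<bar>\<phi> z\<bar>"]) (auto simp: indicator_def cong: measurable_cong_sets)
  qed
  also have "(\<integral>y. indicator {t<..} y * \<phi> z \<partial>clock j) = exp (- L * t) * \<phi> z"
    using measure_clock_greaterThan[of j t] L0 t by (simp add: L_def)
  also have "(\<integral>y. indicator {0..t} y * (h (t - y) / L) \<partial>clock j) =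
      exp (- L * t) * integral {0..t} (\<lambda>v. exp (L * v) * h v)"
  proof -
    have "(\<integral>y. indicator {0..t} y * (h (t - y) / L) \<partial>clock j)
        = (\<integral>y. exponential_density L y * (indicator {0..t} y * (h (t - y) / L)) \<partial>lborel)"
      unfolding clock_def using L0 by (subst integral_density) (auto simp: L_def exponential_density_def)
    also have "\<dots> = (\<integral>y. indicator {0..t} y * (exp (- L * y) * h (t - y)) \<partial>lborel)"
      using L0 by (intro Bochner_Integration.integral_cong) (auto simp: exponential_density_def indicator_def mult_ac)
    also have "\<dots> = (\<integral>v. indicator {0..t} v * (exp (- L * t) * (exp (L * v) * h v)) \<partial>lborel)"
      by (subst lborel_integral_real_affine[where c="-1" and t=t])
         (auto intro!: Bochner_Integration.integral_cong simp: indicator_def algebra_simps simp flip: exp_add)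
    also have "\<dots> = (LINT v:{0..t}|lborel. exp (- L * t) * (exp (L * v) * h v))"
      by (simp only: set_lebesgue_integral_def real_scaleR_def)
    also have "\<dots> = exp (- L * t) * (LINT v:{0..t}|lborel. exp (L * v) * h v)"
      by (rule set_integral_mult_right)
    also have "(LINT v:{0..t}|lborel. exp (L * v) * h v) = integral {0..t} (\<lambda>v. exp (L * v) * h v)"
    proof (intro set_borel_integral_eq_integral borel_integrable_atLeastAtMost')
      show "continuous_on {0..t} (\<lambda>v. exp (L * v) * h v)"
        unfolding h_def by (intro continuous_intros continuous_on_subset[OF cont]) (auto simp: j_def)
    qed
    finally show ?thesis .
  qed
  finally show ?thesis
    by (simp add: h_def L_def j_def algebra_simps)
qed

lemma dual_generator_eq:
  "dual_generator a b \<phi> z = (\<Sum>i=1..snd z. a (snd z) i * \<phi> (jump z i)) - total_rate (snd z) * \<phi> z"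
  by (cases z) (simp add: dual_generator_def jump_def total_rate_def algebra_simps sum_subtractf sum_distrib_left)

text \<open>The induction hypothesis makes the means after the first jump continuous, hence also the
  integrand in the variation-of-constants formula, which can then be differentiated. Derivatives are
  taken within \<open>{0..}\<close> so that \<open>t = 0\<close> is included.\<close>

lemma path_mean_deriv:
  "0 \<le> t \<Longrightarrow> (path_mean \<phi> z has_real_derivative dual_generator a b (\<lambda>z. path_mean \<phi> z t) z) (at t within {0..})"
proof (induction "snd z" arbitrary: z t rule: less_induct)
  case less
  let ?j = "snd z"
  show ?case
  proof (cases "0 < total_rate ?j")
    case False
    \<comment> \<open>The state is absorbing: nonnegative rates with sum 0 all vanish, so the mean
      is constant and the generator is 0 there.\<close>
    then have "total_rate ?j = 0"
      unfolding total_rate_def using sum_nonneg[of "{1..?j}" "a ?j"] rate_nonneg by force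
    moreover from this have "a ?j i = 0" if "i \<in> {1..?j}" for i
      using that rate_nonneg sum_nonneg_eq_0_iff[of "{1..?j}" "a ?j"] by (auto simp: total_rate_def)
    ultimately show ?thesis
      using path_mean_no_rate[OF False, of \<phi>] by (simp add: dual_generator_eq ext[of "path_mean \<phi> z" "\<lambda>_. \<phi> z"])
  next
    case True
    have cont: "continuous_on {0..} (path_mean \<phi> (jump z i))" if "i \<in> {1..?j}" for i
      unfolding continuous_on_eq_continuous_within
      using less.hyps[of "jump z i"] that by (auto intro!: DERIV_continuous)
    define L where "L = total_rate ?j"
    define h where "h = (\<lambda>v. \<Sum>i=1..?j. a ?j i * path_mean \<phi> (jump z i) v)"
    have eq: "path_mean \<phi> z v = exp (- L * v) * (\<phi> z + integral {0..v} (\<lambda>v. exp (L * v) * h v))" if "0 \<le> v" for v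
      using path_mean_variation_of_constants[OF True that cont] by (simp add: L_def h_def)
    \<comment> \<open>The interval reaches beyond \<open>t\<close>, so that near \<open>t\<close> it
      agrees with \<open>{0..}\<close>.\<close>
    have "continuous_on {0..t + 1} (\<lambda>v. exp (L * v) * h v)"
      unfolding h_def by (intro continuous_intros continuous_on_subset[OF cont]) auto
    then have "((\<lambda>v. integral {0..v} (\<lambda>v. exp (L * v) * h v)) has_real_derivative exp (L * t) * h t) (at t within {0..t + 1})"
      using less.prems by (intro integral_has_real_derivative) auto
    moreover have "at t within {0..t + 1} = at t within {0..}"
      by (rule at_within_nhd[of _ "{..<t + 1}"]) auto
    ultimately have "((\<lambda>v. exp (- L * v) * (\<phi> z + integral {0..v} (\<lambda>v. exp (L * v) * h v))) has_real_derivative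
        - L * path_mean \<phi> z t + h t) (at t within {0..})"
      using less.prems by (auto intro!: derivative_eq_intros simp: eq algebra_simps simp flip: exp_add)
    then have "(path_mean \<phi> z has_real_derivative - L * path_mean \<phi> z t + h t) (at t within {0..})"
      by (rule has_field_derivative_transform_within[where d=1]) (use less.prems in \<open>auto simp: eq\<close>)
    then show ?thesis
      by (simp add: dual_generator_eq h_def L_def)
  qed
qed

theorem markov_jump_process_path:
  assumes z: "z \<in> mono_states k"
  shows "markov_jump_process \<Omega> (mono_states k) (dual_generator a b) (\<lambda>t \<omega>. path z \<omega> t)"
  unfolding markov_jump_process_def
proof (intro conjI ballI allI impI exI[of _ "transition k"])
  show "transition_semigroup (count_space (mono_states k)) (transition k)"
    by (rule transition_semigroup_transition)
  show "markov_process \<Omega> (count_space (mono_states k)) (transition k) (\<lambda>t \<omega>. path z \<omega> t)"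
    using z by (rule markov_process_path)
next
  fix \<omega> and t :: real assume "0 \<le> t"
  then show "\<forall>\<^sub>F s in at_right t. path z \<omega> s = path z \<omega> t"
    by (rule path_right_continuous)
next
  fix \<omega> and t :: real assume "0 < t"
  then show "\<exists>z'\<in>mono_states k. \<forall>\<^sub>F s in at_left t. path z \<omega> s = z'"
    using path_left_limit[of t z \<omega>] z by (fastforce simp: mono_states_iff)
next
  fix \<phi> :: "real \<times> nat \<Rightarrow> real" and y and t :: real assume y: "y \<in> mono_states k"
  show "integrable (transition k t y) \<phi>"
    unfolding transition_def
    by (rule integrable_distr_eq[THEN iffD2]) (simp_all add: y measurable_path_mono_states integrable_path)
next
  fix \<phi> :: "real \<times> nat \<Rightarrow> real" and y assume y: "y \<in> mono_states k"
  have op: "semigroup_op (transition k) t \<phi> y = path_mean \<phi> y t" for t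
    unfolding semigroup_op_def transition_def path_mean_def using y
    by (subst integral_distr) (auto intro: measurable_path_mono_states)
  \<comment> \<open>The generator is read off from the backward equation at time 0, where the means
    reduce to \<open>\<phi>\<close>.\<close>
  have "(path_mean \<phi> y has_real_derivative dual_generator a b \<phi> y) (at 0 within {0..})"
    using path_mean_deriv[of 0 \<phi> y] by simp
  then have "((\<lambda>t. (path_mean \<phi> y t - \<phi> y) / t) \<longlongrightarrow> dual_generator a b \<phi> y) (at 0 within {0..})"
    by (simp add: has_field_derivative_iff)
  then show "((\<lambda>t. (semigroup_op (transition k) t \<phi> y - \<phi> y) / t) \<longlongrightarrow> dual_generator a b \<phi> y) (at_right 0)"
    unfolding op by (rule tendsto_within_subset) auto
qed

text \<open>Uniqueness for the triangular system, with the moments of the diffusion abstracted to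
  \<open>u\<close>. By induction the lower-degree terms agree, so the difference of the two sides
  solves a homogeneous scalar equation with rate \<open>- total_rate j\<close>. The coefficient
  \<open>c\<close> must be arbitrary because a jump multiplies it by \<open>b j i\<close>.\<close>

lemma path_mean_mono_val:
  assumes deriv: "\<And>j t. j \<le> k \<Longrightarrow> 0 \<le> t \<Longrightarrow>
      (u j has_real_derivative (\<Sum>i=1..j. a j i * (b j i * u (j - i) t - u j t))) (at t within {0..})"
    and init: "\<And>j. j \<le> k \<Longrightarrow> u j 0 = x ^ j"
  shows "j \<le> k \<Longrightarrow> 0 \<le> t \<Longrightarrow> path_mean (mono_val x) (c, j) t = c * u j t"
proof (induction j arbitrary: c t rule: less_induct)
  case (less j)
  \<comment> \<open>With the integrating factor the difference has derivative 0, and it vanishes at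
    time 0 by \<open>init\<close>.\<close>
  define d where "d = (\<lambda>t. exp (total_rate j * t) * (path_mean (mono_val x) (c, j) t - c * u j t))"
  have "(d has_real_derivative 0) (at t within {0..})" if t: "t \<in> {0..}" for t
  proof -
    have "(\<Sum>i=1..j. a j i * path_mean (mono_val x) (jump (c, j) i) t) = (\<Sum>i=1..j. a j i * (c * b j i * u (j - i) t))"
      using less t by (intro sum.cong refl) (simp add: jump_def)
    then have "dual_generator a b (\<lambda>z. path_mean (mono_val x) z t) (c, j) - c * (\<Sum>i=1..j. a j i * (b j i * u (j - i) t - u j t))
        = - total_rate j * (path_mean (mono_val x) (c, j) t - c * u j t)"
      by (simp add: dual_generator_eq total_rate_def sum_distrib_left sum_distrib_right algebra_simps sum_subtractf)
    moreover have "((\<lambda>t. path_mean (mono_val x) (c, j) t - c * u j t) has_real_derivative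
        dual_generator a b (\<lambda>z. path_mean (mono_val x) z t) (c, j) -
        c * (\<Sum>i=1..j. a j i * (b j i * u (j - i) t - u j t))) (at t within {0..})"
      using t less.prems by (intro DERIV_diff path_mean_deriv DERIV_cmult deriv) auto
    ultimately have "((\<lambda>t. path_mean (mono_val x) (c, j) t - c * u j t) has_real_derivative
        - total_rate j * (path_mean (mono_val x) (c, j) t - c * u j t)) (at t within {0..})"
      by simp
    moreover have "((\<lambda>t. exp (total_rate j * t)) has_real_derivative total_rate j * exp (total_rate j * t)) (at t within {0..})"
      by (auto intro!: derivative_eq_intros)
    ultimately show ?thesis
      unfolding d_def using DERIV_mult by (fastforce simp: algebra_simps)
  qed
  then obtain C where "\<And>t. t \<in> {0..} \<Longrightarrow> d t = C"
    using has_field_derivative_zero_constant[of "{0..}" d] by auto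
  then have "d t = d 0" using less.prems by simp
  then show ?case
    using init[OF less.prems(1)] by (simp add: d_def mono_val_def)
qed

end

section \<open>Feller semigroups on weighted spaces\<close>

lemma is_generator_graph: "is_generator S w P D A \<Longrightarrow> f \<in> D \<Longrightarrow> generator_graph S w P f (A f)"
  by (simp add: is_generator_def)

locale weighted_feller =
  fixes S :: "real set" and w :: "real \<Rightarrow> real" and P :: "real \<Rightarrow> real \<Rightarrow> real measure"
  assumes feller: "feller_semigroup S w P"
begin

abbreviation E :: "real measure" where
  "E \<equiv> restrict_space borel S"

lemma space_E [simp]: "space E = S"
  by (simp add: space_restrict_space)

lemma continuous_weight: "continuous_on S w" and weight_ge_1: "x \<in> S \<Longrightarrow> 1 \<le> w x"
  and transition_semigroup: "transition_semigroup E P"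
  using feller by (auto simp: feller_semigroup_def)

lemma measurable_kernel: "0 \<le> t \<Longrightarrow> P t \<in> measurable E (prob_algebra E)"
  using transition_semigroup by (auto simp: transition_semigroup_def)

lemma kernel:
  assumes "0 \<le> t" "x \<in> S"
  shows prob_space_kernel: "prob_space (P t x)" and sets_kernel_E: "sets (P t x) = sets E"
    and space_kernel_E: "space (P t x) = S"
proof -
  have "P t x \<in> space (prob_algebra E)"
    using measurable_space[OF measurable_kernel[OF assms(1)], of x] assms by simp
  then show 1: "prob_space (P t x)" and 2: "sets (P t x) = sets E"
    by (auto simp: space_prob_algebra)
  show "space (P t x) = S"
    using sets_eq_imp_space_eq[OF 2] by simp
qed

lemma measurable_weight [measurable]: "w \<in> borel_measurable E"
  using continuous_weight by (rule borel_measurable_continuous_on_restrict)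

lemma measurable_C0: "f \<in> weighted_C0 S w \<Longrightarrow> f \<in> borel_measurable E"
  by (auto simp: weighted_C0_def intro: borel_measurable_continuous_on_restrict)

text \<open>Off a compact set the definition with \<open>\<epsilon> = 1\<close> gives the bound; on
  it \<open>f\<close> is bounded by a constant, which \<open>1 \<le> w x\<close> allows the weight
  to absorb.\<close>

lemma C0_bounded:
  assumes f: "f \<in> weighted_C0 S w"
  obtains C where "0 \<le> C" "\<And>x. x \<in> S \<Longrightarrow> \<bar>f x\<bar> \<le> C * w x"
proof -
  have "\<exists>K. compact K \<and> K \<subseteq> S \<and> (\<forall>x\<in>S - K. \<bar>f x\<bar> \<le> 1 * w x)"
    using f unfolding weighted_C0_def mem_Collect_eq by (metis zero_less_one)
  then obtain K where K: "compact K" "K \<subseteq> S" "\<And>x. x \<in> S - K \<Longrightarrow> \<bar>f x\<bar> \<le> w x"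
    by auto
  have "continuous_on K f"
    using f K(2) by (auto simp: weighted_C0_def intro: continuous_on_subset)
  then have "bounded (f ` K)"
    using K(1) by (intro compact_imp_bounded compact_continuous_image)
  then obtain B where B: "\<And>x. x \<in> K \<Longrightarrow> \<bar>f x\<bar> \<le> B"
    by (auto simp: bounded_iff)
  show ?thesis
  proof (rule that[of "max 1 B"])
    fix x assume x: "x \<in> S"
    have "\<bar>f x\<bar> \<le> max 1 B * 1 \<or> \<bar>f x\<bar> \<le> 1 * w x"
      using B K(3) x by fastforce
    moreover have "max 1 B * 1 \<le> max 1 B * w x" "1 * w x \<le> max 1 B * w x"
      using weight_ge_1[OF x] by (intro mult_left_mono mult_right_mono; simp)+
    ultimately show "\<bar>f x\<bar> \<le> max 1 B * w x" by linarith
  qed simp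
qed

section \<open>Semigroup law for functions dominated by the weight\<close>

lemma kernel_bind:
  "0 \<le> s \<Longrightarrow> 0 \<le> t \<Longrightarrow> x \<in> S \<Longrightarrow> P (s + t) x = P s x \<bind> P t"
  using transition_semigroup by (simp add: transition_semigroup_def)

lemma nn_integral_kernel_add:
  assumes st: "0 \<le> s" "0 \<le> t" and x: "x \<in> S" and f: "f \<in> borel_measurable E"
  shows "(\<integral>\<^sup>+y. f y \<partial>P (s + t) x) = (\<integral>\<^sup>+y. \<integral>\<^sup>+y'. f y' \<partial>P t y \<partial>P s x)"
proof -
  have "P t \<in> measurable (P s x) (subprob_algebra E)"
    using measurable_prob_algebraD[OF measurable_kernel[OF st(2)]] sets_kernel_E[OF st(1) x]
    by (simp cong: measurable_cong_sets)
  then show ?thesis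
    using f by (simp add: kernel_bind[OF st x] nn_integral_bind)
qed

text \<open>The Feller property controls \<open>w\<close> only for times up to 1. Chapman-Kolmogorov
  chains unit steps, each at the price of one more factor \<open>C\<close>.\<close>

lemma nn_integral_weight_bound:
  "\<exists>B\<ge>0. \<forall>t\<in>{0..T}. \<forall>x\<in>S. (\<integral>\<^sup>+y. ennreal (w y) \<partial>P t x) \<le> ennreal (B * w x)"
proof -
  obtain C0 where C0: "\<And>t x. t \<in> {0..1} \<Longrightarrow> x \<in> S \<Longrightarrow> (\<integral>\<^sup>+y. ennreal (w y) \<partial>P t x) \<le> ennreal (C0 * w x)"
    using feller unfolding feller_semigroup_def by blast
  \<comment> \<open>A constant of at least 1 has increasing powers, so the bound for short times
    fits under the one for longer intervals.\<close>
  define C where "C = max C0 1"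
  have C: "(\<integral>\<^sup>+y. ennreal (w y) \<partial>P t x) \<le> ennreal (C * w x)" if "t \<in> {0..1}" "x \<in> S" for t x
    using C0[OF that] weight_ge_1[OF that(2)]
    by (elim order_trans) (auto simp: C_def intro!: ennreal_leI mult_right_mono)
  have C1: "1 \<le> C" by (simp add: C_def)
  have step: "(\<integral>\<^sup>+y. ennreal (w y) \<partial>P t x) \<le> ennreal (C ^ Suc n * w x)" if "t \<in> {0..real (Suc n)}" "x \<in> S" for n t x
    using that
  proof (induction n arbitrary: t x)
    case 0
    then show ?case using C by simp
  next
    case (Suc n)
    show ?case
    proof (cases "t \<le> 1")
      case True
      have "C * w x \<le> C ^ Suc (Suc n) * w x"
        using C1 weight_ge_1[OF Suc.prems(2)] self_le_power[of C "Suc (Suc n)"] by (intro mult_right_mono) auto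
      then show ?thesis
        using C[of t x] True Suc.prems by (auto intro: order_trans ennreal_leI)
    next
      case False
      have "(\<integral>\<^sup>+y. ennreal (w y) \<partial>P (1 + (t - 1)) x) = (\<integral>\<^sup>+y. \<integral>\<^sup>+y'. ennreal (w y') \<partial>P (t - 1) y \<partial>P 1 x)"
        using False Suc.prems by (intro nn_integral_kernel_add) auto
      also have "\<dots> \<le> (\<integral>\<^sup>+y. ennreal (C ^ Suc n) * ennreal (w y) \<partial>P 1 x)"
      proof (rule nn_integral_mono)
        fix y assume "y \<in> space (P 1 x)"
        then have "y \<in> S" using space_kernel_E[of 1 x] Suc.prems by simp
        then have "(\<integral>\<^sup>+y'. ennreal (w y') \<partial>P (t - 1) y) \<le> ennreal (C ^ Suc n * w y)"
          using False Suc.prems by (intro Suc.IH) auto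
        then show "(\<integral>\<^sup>+y'. ennreal (w y') \<partial>P (t - 1) y) \<le> ennreal (C ^ Suc n) * ennreal (w y)"
          using C1 by (subst ennreal_mult'[symmetric]) auto
      qed
      also have "\<dots> = ennreal (C ^ Suc n) * (\<integral>\<^sup>+y. ennreal (w y) \<partial>P 1 x)"
        using sets_kernel_E[of 1 x] Suc.prems by (intro nn_integral_cmult) (simp cong: measurable_cong_sets)
      also have "\<dots> \<le> ennreal (C ^ Suc n) * ennreal (C * w x)"
        using C[of 1 x] Suc.prems by (intro mult_left_mono) auto
      also have "\<dots> = ennreal (C ^ Suc (Suc n) * w x)"
        using C1 by (subst ennreal_mult'[symmetric]) (auto simp: mult_ac)
      finally show ?thesis by simp
    qed
  qed
  obtain n where "T \<le> real (Suc n)"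
    using real_arch_simple[of T] by (metis le_SucI of_nat_le_iff order_refl order_trans)
  then show ?thesis
    using step[of _ n] C1 by (intro exI[of _ "C ^ Suc n"]) auto
qed

lemma integrable_weight:
  assumes "0 \<le> t" "x \<in> S"
  shows "integrable (P t x) w"
proof -
  obtain B where "(\<integral>\<^sup>+y. ennreal (w y) \<partial>P t x) \<le> ennreal (B * w x)"
    using nn_integral_weight_bound[of t] assms by (meson atLeastAtMost_iff order_refl)
  then have "(\<integral>\<^sup>+y. ennreal (w y) \<partial>P t x) < \<infinity>"
    by (simp add: le_less_trans)
  moreover have "AE y in P t x. 0 \<le> w y"
    using space_kernel_E[OF assms] weight_ge_1 by (intro AE_I2) fastforce
  ultimately show ?thesis
    using sets_kernel_E[OF assms] by (intro integrableI_nonneg) (simp_all cong: measurable_cong_sets)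
qed

lemma integrable_le_weight:
  assumes "0 \<le> t" "x \<in> S" "f \<in> borel_measurable E" "\<And>y. y \<in> S \<Longrightarrow> \<bar>f y\<bar> \<le> C * w y"
  shows "integrable (P t x) f"
proof (rule Bochner_Integration.integrable_bound)
  show "integrable (P t x) (\<lambda>y. C * w y)"
    using integrable_weight[OF assms(1,2)] by simp
  show "f \<in> borel_measurable (P t x)"
    using assms sets_kernel_E[OF assms(1,2)] by (simp cong: measurable_cong_sets)
  show "AE y in P t x. norm (f y) \<le> norm (C * w y)"
    using assms(4) space_kernel_E[OF assms(1,2)] by (intro AE_I2) force
qed

lemma integrable_C0:
  assumes "0 \<le> t" "x \<in> S" "f \<in> weighted_C0 S w"
  shows "integrable (P t x) f"
proof -
  obtain C where "\<And>y. y \<in> S \<Longrightarrow> \<bar>f y\<bar> \<le> C * w y" using C0_bounded[OF assms(3)] by blast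
  then show ?thesis
    using assms by (intro integrable_le_weight measurable_C0)
qed

text \<open>
  Stated for nonnegative functions first because integration against a bind is available for
  unbounded functions only in the form of the nonnegative integral.
\<close>

lemma semigroup_op_add_nonneg:
  assumes st: "0 \<le> s" "0 \<le> t" and x: "x \<in> S" and f: "f \<in> borel_measurable E"
    and bd: "\<And>y. y \<in> S \<Longrightarrow> 0 \<le> f y \<and> f y \<le> C * w y"
  shows "semigroup_op P (s + t) f x = semigroup_op P s (semigroup_op P t f) x"
    and "integrable (P s x) (semigroup_op P t f)"
proof -
  have nn: "(\<integral>\<^sup>+y'. ennreal (f y') \<partial>P r y) = ennreal (semigroup_op P r f y)" if "0 \<le> r" "y \<in> S" for r y
    unfolding semigroup_op_def
  proof (rule nn_integral_eq_integral)
    show "integrable (P r y) f"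
      using that f bd by (intro integrable_le_weight[where C=C]) (simp_all add: abs_of_nonneg)
    show "AE y' in P r y. 0 \<le> f y'"
      using bd space_kernel_E[OF that] by (intro AE_I2) auto
  qed
  have pos: "0 \<le> semigroup_op P r f y" if "0 \<le> r" "y \<in> S" for r y
    unfolding semigroup_op_def using bd space_kernel_E[OF that] by (intro integral_nonneg_AE AE_I2) auto
  have "semigroup_op P t f \<in> borel_measurable E"
    unfolding semigroup_op_def[abs_def]
    by (rule measurable_compose[OF measurable_prob_algebraD[OF measurable_kernel[OF st(2)]]
          integral_measurable_subprob_algebra[OF f]])
  then have m: "semigroup_op P t f \<in> borel_measurable (P s x)"
    using sets_kernel_E[OF st(1) x] by (simp cong: measurable_cong_sets)
  have eq: "ennreal (semigroup_op P (s + t) f x) = (\<integral>\<^sup>+y. ennreal (semigroup_op P t f y) \<partial>P s x)"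
    unfolding nn[of "s + t" x, OF add_nonneg_nonneg[OF st] x, symmetric]
    using f st x space_kernel_E[OF st(1) x]
    by (subst nn_integral_kernel_add) (auto intro!: nn_integral_cong nn)
  have ae: "AE y in P s x. 0 \<le> semigroup_op P t f y"
    using pos[OF st(2)] space_kernel_E[OF st(1) x] by (intro AE_I2) auto
  \<comment> \<open>By \<open>eq\<close> the nonnegative integral is a real number, hence
    finite.\<close>
  show int: "integrable (P s x) (semigroup_op P t f)"
    using m ae by (intro integrableI_nonneg) (simp_all flip: eq)
  have "ennreal (semigroup_op P (s + t) f x) = ennreal (semigroup_op P s (semigroup_op P t f) x)"
    unfolding eq unfolding semigroup_op_def[of P s] by (rule nn_integral_eq_integral[OF int ae])
  moreover have "0 \<le> semigroup_op P s (semigroup_op P t f) x"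
    unfolding semigroup_op_def[of P s] using ae by (rule integral_nonneg_AE)
  ultimately show "semigroup_op P (s + t) f x = semigroup_op P s (semigroup_op P t f) x"
    using pos[of "s + t" x] st x by simp
qed

text \<open>Adding and subtracting \<open>C * w\<close> writes \<open>f\<close> as a difference of
  nonnegative functions dominated by the weight. These need not lie in
  \<open>weighted_C0 S w\<close>, which is why the nonnegative version asks only for measurability
  and domination.\<close>

lemma semigroup_op_add:
  assumes st: "0 \<le> s" "0 \<le> t" and x: "x \<in> S" and f: "f \<in> weighted_C0 S w"
  shows "semigroup_op P (s + t) f x = semigroup_op P s (semigroup_op P t f) x"
proof -
  obtain C where C: "0 \<le> C" "\<And>y. y \<in> S \<Longrightarrow> \<bar>f y\<bar> \<le> C * w y" using C0_bounded[OF f] by blast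
  define g where "g = (\<lambda>y. f y + C * w y)"
  define v where "v = (\<lambda>y. C * w y)"
  have gm: "g \<in> borel_measurable E" and vm: "v \<in> borel_measurable E"
    using measurable_C0[OF f] unfolding g_def v_def by measurable
  have gb: "0 \<le> g y \<and> g y \<le> (2 * C) * w y" if "y \<in> S" for y
    using C(2)[OF that] by (simp add: g_def abs_le_iff)
  have vb: "0 \<le> v y \<and> v y \<le> C * w y" if "y \<in> S" for y
    using C(1) weight_ge_1[OF that] by (simp add: v_def)
  have diff: "semigroup_op P r f y = semigroup_op P r g y - semigroup_op P r v y" if "0 \<le> r" "y \<in> S" for r y
  proof -
    have "integrable (P r y) f" "integrable (P r y) v"
      using integrable_C0[OF that f] integrable_weight[OF that] by (simp_all add: v_def)
    then show ?thesis by (simp add: semigroup_op_def g_def v_def)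
  qed
  have "semigroup_op P s (semigroup_op P t f) x =
      (\<integral>y. semigroup_op P t g y - semigroup_op P t v y \<partial>P s x)"
    unfolding semigroup_op_def[of P s] using diff[OF st(2)] space_kernel_E[OF st(1) x]
    by (intro Bochner_Integration.integral_cong) auto
  also have "\<dots> = semigroup_op P s (semigroup_op P t g) x - semigroup_op P s (semigroup_op P t v) x"
    unfolding semigroup_op_def[of P s]
    by (intro Bochner_Integration.integral_diff
        semigroup_op_add_nonneg(2)[OF st x gm gb] semigroup_op_add_nonneg(2)[OF st x vm vb])
  also have "\<dots> = semigroup_op P (s + t) f x"
    using semigroup_op_add_nonneg(1)[OF st x gm gb] semigroup_op_add_nonneg(1)[OF st x vm vb] diff[of "s + t" x] st x
    by simp
  finally show ?thesis ..
qed

section \<open>Differentiation along the semigroup and the moment equations\<close>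

lemma abs_integral_le_weight:
  assumes t0: "0 \<le> t" and x: "x \<in> S" and "0 \<le> e"
    and f: "integrable (P t x) f" and le: "\<And>y. y \<in> S \<Longrightarrow> \<bar>f y\<bar> \<le> e * w y"
    and B: "(\<integral>\<^sup>+y. ennreal (w y) \<partial>P t x) \<le> ennreal (B * w x)" "0 \<le> B"
  shows "\<bar>\<integral>y. f y \<partial>P t x\<bar> \<le> e * (B * w x)"
proof -
  have "\<bar>\<integral>y. f y \<partial>P t x\<bar> \<le> (\<integral>y. \<bar>f y\<bar> \<partial>P t x)"
    by (rule integral_abs_bound)
  also have "\<dots> \<le> (\<integral>y. e * w y \<partial>P t x)"
    using f le space_kernel_E[OF t0 x] integrable_weight[OF t0 x] by (intro integral_mono) auto
  also have "\<dots> = e * (\<integral>y. w y \<partial>P t x)" by simp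
  also have "(\<integral>y. w y \<partial>P t x) \<le> B * w x"
  proof -
    have "AE y in P t x. 0 \<le> w y"
      using space_kernel_E[OF t0 x] weight_ge_1 by (intro AE_I2) fastforce
    from nn_integral_eq_integral[OF integrable_weight[OF t0 x] this]
    have "ennreal (\<integral>y. w y \<partial>P t x) \<le> ennreal (B * w x)" using B by simp
    then show ?thesis
      using B(2) weight_ge_1[OF x] by (subst (asm) ennreal_le_iff) auto
  qed
  finally show ?thesis using \<open>0 \<le> e\<close> by (simp add: mult_left_mono)
qed

text \<open>From the right, the error of the difference quotient is \<open>P t\<close> applied to
  the error at time 0, which is small in the weighted norm. From the left, the same estimate based
  at the earlier time \<open>r\<close> produces \<open>P r\<close> applied to \<open>g\<close>;
  strong continuity closes the gap to \<open>P t\<close>.\<close>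

lemma semigroup_op_deriv:
  assumes gen: "generator_graph S w P f g" and x: "x \<in> S" and t: "0 \<le> t"
  shows "((\<lambda>t. semigroup_op P t f x) has_real_derivative semigroup_op P t g x) (at t within {0..})"
proof -
  have f: "f \<in> weighted_C0 S w" and g: "g \<in> weighted_C0 S w"
    and lim: "uniform_limit S (\<lambda>t x. ((semigroup_op P t f x - f x) / t) / w x) (\<lambda>x. g x / w x) (at_right 0)"
    using gen by (auto simp: generator_graph_def)
  have limg: "uniform_limit S (\<lambda>t x. semigroup_op P t g x / w x) (\<lambda>x. g x / w x) (at_right 0)"
    using feller g by (auto simp: feller_semigroup_def)
  have inv: "semigroup_op P r h \<in> weighted_C0 S w" if "h \<in> weighted_C0 S w" "0 \<le> r" for r h
    using feller that by (auto simp: feller_semigroup_def)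
  \<comment> \<open>The horizon \<open>t + 1\<close> covers all times within distance 1 of
    \<open>t\<close>, so a single \<open>B\<close> serves both sides.\<close>
  obtain B where B: "0 \<le> B"
    "\<And>s x. s \<in> {0..t + 1} \<Longrightarrow> x \<in> S \<Longrightarrow> (\<integral>\<^sup>+y. ennreal (w y) \<partial>P s x) \<le> ennreal (B * w x)"
    using nn_integral_weight_bound[of "t + 1"] by blast
  have Bw: "0 \<le> B * w x" using B(1) weight_ge_1[OF x] by simp
  have w_pos: "0 < w y" if "y \<in> S" for y using weight_ge_1[OF that] by simp
  show ?thesis
    unfolding has_field_derivative_iff
  proof (rule tendstoI)
    fix \<epsilon> :: real assume "0 < \<epsilon>"
    \<comment> \<open>The factor 2 accounts for the two errors in the left-hand case; the added 1
      keeps the denominator positive and the resulting bound strict.\<close>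
    define e where "e = \<epsilon> / (2 * (B * w x) + 1)"
    have e: "0 < e" "2 * (e * (B * w x)) < \<epsilon>"
      using \<open>0 < \<epsilon>\<close> Bw by (auto simp: e_def field_simps add_pos_nonneg)
    have "\<forall>\<^sub>F h in at_right 0. (\<forall>y\<in>S. dist (((semigroup_op P h f y - f y) / h) / w y) (g y / w y) < e) \<and>
        (\<forall>y\<in>S. dist (semigroup_op P h g y / w y) (g y / w y) < e)"
      using uniform_limitD[OF lim e(1)] uniform_limitD[OF limg e(1)] by (rule eventually_conj)
    then obtain \<delta> where \<delta>: "0 < \<delta>"
      "\<And>h y. 0 < h \<Longrightarrow> h < \<delta> \<Longrightarrow> y \<in> S \<Longrightarrow> dist (((semigroup_op P h f y - f y) / h) / w y) (g y / w y) < e"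
      "\<And>h y. 0 < h \<Longrightarrow> h < \<delta> \<Longrightarrow> y \<in> S \<Longrightarrow> dist (semigroup_op P h g y / w y) (g y / w y) < e"
      by (auto simp: eventually_at_right_field)
    have bd: "\<bar>(semigroup_op P r f x - semigroup_op P s f x) / (r - s) - semigroup_op P s g x\<bar> \<le> e * (B * w x)"
      "\<bar>semigroup_op P r g x - semigroup_op P s g x\<bar> \<le> e * (B * w x)"
      if sr: "0 \<le> s" "s < r" "r \<le> t + 1" "r - s < \<delta>" for s r
    proof -
      let ?h = "r - s"
      have h: "0 < ?h" "0 \<le> ?h" "s + ?h = r" using sr by auto
      have i: "integrable (P s x) f" "integrable (P s x) g"
        "integrable (P s x) (semigroup_op P ?h f)" "integrable (P s x) (semigroup_op P ?h g)"
        using sr(1) x h f g by (auto intro!: integrable_C0 inv)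
      have eq: "semigroup_op P r q x = (\<integral>y. semigroup_op P ?h q y \<partial>P s x)" if "q \<in> weighted_C0 S w" for q
        using semigroup_op_add[OF sr(1) h(2) x that] h(3) by (simp add: semigroup_op_def[of P s])
      have "(semigroup_op P r f x - semigroup_op P s f x) / ?h - semigroup_op P s g x
          = (\<integral>y. (semigroup_op P ?h f y - f y) / ?h - g y \<partial>P s x)"
        using i by (simp add: eq[OF f] semigroup_op_def[of P s])
      also have "\<bar>\<dots>\<bar> \<le> e * (B * w x)"
      proof (rule abs_integral_le_weight)
        fix y assume y: "y \<in> S"
        have "\<bar>((semigroup_op P ?h f y - f y) / ?h - g y) / w y\<bar> < e"
          using \<delta>(2)[OF h(1) sr(4) y] by (simp add: dist_real_def diff_divide_distrib)
        then show "\<bar>(semigroup_op P ?h f y - f y) / ?h - g y\<bar> \<le> e * w y"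
          using w_pos[OF y] by (simp add: abs_divide pos_divide_less_eq)
      qed (use sr x e B i in auto)
      finally show "\<bar>(semigroup_op P r f x - semigroup_op P s f x) / (r - s) - semigroup_op P s g x\<bar> \<le> e * (B * w x)" .
      have "semigroup_op P r g x - semigroup_op P s g x = (\<integral>y. semigroup_op P ?h g y - g y \<partial>P s x)"
        using i by (simp add: eq[OF g] semigroup_op_def[of P s])
      also have "\<bar>\<dots>\<bar> \<le> e * (B * w x)"
      proof (rule abs_integral_le_weight)
        fix y assume y: "y \<in> S"
        have "\<bar>(semigroup_op P ?h g y - g y) / w y\<bar> < e"
          using \<delta>(3)[OF h(1) sr(4) y] by (simp add: dist_real_def diff_divide_distrib)
        then show "\<bar>semigroup_op P ?h g y - g y\<bar> \<le> e * w y"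
          using w_pos[OF y] by (simp add: abs_divide pos_divide_less_eq)
      qed (use sr x e B i in auto)
      finally show "\<bar>semigroup_op P r g x - semigroup_op P s g x\<bar> \<le> e * (B * w x)" .
    qed
    have near: "\<bar>(semigroup_op P r f x - semigroup_op P t f x) / (r - t) - semigroup_op P t g x\<bar> < \<epsilon>"
      if r: "0 \<le> r" "r \<noteq> t" "\<bar>r - t\<bar> < min \<delta> 1" for r
    proof (cases "t < r")
      case True
      then show ?thesis
        using bd(1)[of t r] r t e mult_nonneg_nonneg[OF _ Bw, of e] by auto
    next
      case False
      then have "\<bar>(semigroup_op P t f x - semigroup_op P r f x) / (t - r) - semigroup_op P r g x\<bar> \<le> e * (B * w x)"
        "\<bar>semigroup_op P t g x - semigroup_op P r g x\<bar> \<le> e * (B * w x)"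
        using bd[of r t] r by auto
      moreover have "(semigroup_op P t f x - semigroup_op P r f x) / (t - r) =
          (semigroup_op P r f x - semigroup_op P t f x) / (r - t)"
        by (metis minus_diff_eq minus_divide_divide)
      ultimately show ?thesis using e(2) by linarith
    qed
    have "\<forall>\<^sub>F r in at t within {0..}. 0 \<le> r \<and> r \<noteq> t \<and> \<bar>r - t\<bar> < min \<delta> 1"
      using \<delta>(1) by (auto simp: eventually_at dist_real_def intro!: exI[of _ "min \<delta> 1"])
    then show "\<forall>\<^sub>F r in at t within {0..}. dist ((semigroup_op P r f x - semigroup_op P t f x) / (r - t)) (semigroup_op P t g x) < \<epsilon>"
      by eventually_elim (simp add: dist_real_def near)
  qed
qed

text \<open>The action of \<open>A\<close> on a power involves only powers of at most the same
  degree, so the moments form a closed system.\<close>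

lemma moment_deriv:
  assumes gen: "is_generator S w P D A"
    and domain: "\<And>i. i \<in> {1..j} \<Longrightarrow> (\<lambda>y. y ^ i) \<in> D"
    and action: "\<And>y. 1 \<le> j \<Longrightarrow> y \<in> S \<Longrightarrow>
      A (\<lambda>y. y ^ j) y = (\<Sum>i=1..j. a j i * (b j i * y ^ (j - i) - y ^ j))"
    and x: "x \<in> S" and t: "0 \<le> t"
  shows "((\<lambda>t. semigroup_op P t (\<lambda>y. y ^ j) x) has_real_derivative
    (\<Sum>i=1..j. a j i * (b j i * semigroup_op P t (\<lambda>y. y ^ (j - i)) x - semigroup_op P t (\<lambda>y. y ^ j) x)))
    (at t within {0..})"
proof (cases "j = 0")
  case True
  \<comment> \<open>Degree 0 lies outside the range of \<open>domain\<close>; its moment is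
    constantly 1 because the kernels are probability measures.\<close>
  have "((\<lambda>t. semigroup_op P t (\<lambda>y. y ^ j) x) has_real_derivative 0) (at t within {0..})"
  proof (rule has_field_derivative_transform_within[where d=1 and f="\<lambda>_. 1"])
    fix r :: real assume "r \<in> {0..}"
    then show "1 = semigroup_op P r (\<lambda>y. y ^ j) x"
      using prob_space.prob_space[OF prob_space_kernel[of r x]] x True by (simp add: semigroup_op_def)
  qed (use t in auto)
  then show ?thesis using True by simp
next
  case False
  interpret prob_space "P t x" using t x by (rule prob_space_kernel)
  have C0: "(\<lambda>y. y ^ i) \<in> weighted_C0 S w" if "i \<in> {1..j}" for i
    using is_generator_graph[OF gen domain[OF that]] by (simp add: generator_graph_def)
  have int: "integrable (P t x) (\<lambda>y. y ^ i)" if "i \<le> j" for i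
    using integrable_C0[OF t x C0[of i]] that by (cases "i = 0") auto
  have "generator_graph S w P (\<lambda>y. y ^ j) (A (\<lambda>y. y ^ j))"
    using False by (intro is_generator_graph[OF gen domain]) simp
  from semigroup_op_deriv[OF this x t]
  have "((\<lambda>t. semigroup_op P t (\<lambda>y. y ^ j) x) has_real_derivative semigroup_op P t (A (\<lambda>y. y ^ j)) x) (at t within {0..})" .
  also have "semigroup_op P t (A (\<lambda>y. y ^ j)) x =
      (\<integral>y. (\<Sum>i=1..j. a j i * (b j i * y ^ (j - i) - y ^ j)) \<partial>P t x)"
    unfolding semigroup_op_def using False action space_kernel_E[OF t x]
    by (intro Bochner_Integration.integral_cong) auto
  also have "\<dots> = (\<Sum>i=1..j. a j i * (b j i * semigroup_op P t (\<lambda>y. y ^ (j - i)) x - semigroup_op P t (\<lambda>y. y ^ j) x))"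
    unfolding semigroup_op_def using int
    by (subst Bochner_Integration.integral_sum) (auto intro!: sum.cong)
  finally show ?thesis .
qed

end

text \<open>The Markov property speaks of conditional laws. At time 0 the process sits at
  \<open>x\<close> almost surely, so the conditional probability is the constant
  \<open>measure (P t x) C\<close>, and integration removes the conditioning.\<close>

lemma distr_markov_process:
  assumes mp: "markov_process M E P X" and init: "AE \<omega> in M. X 0 \<omega> = x" and x: "x \<in> space E"
    and t: "0 \<le> t" and P: "P t \<in> measurable E (prob_algebra E)"
  shows "distr M E (X t) = P t x"
proof (rule measure_eqI)
  interpret prob_space M using mp by (simp add: markov_process_def)
  have Xm [measurable]: "X s \<in> measurable M E" if "0 \<le> s" for s using mp that by (simp add: markov_process_def)
  have Px: "P t x \<in> space (prob_algebra E)" using measurable_space[OF P x] .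
  then interpret Px: prob_space "P t x" by (simp add: space_prob_algebra)
  show "sets (distr M E (X t)) = sets (P t x)"
    using Px by (simp add: space_prob_algebra)
  fix C assume "C \<in> sets (distr M E (X t))"
  then have C [measurable]: "C \<in> sets E" by simp
  let ?F = "natural_filtration M E X 0"
  have "sets ?F \<subseteq> sets M"
    unfolding natural_filtration_def
    by (subst sets_measure_of) (auto intro!: sets.sigma_sets_subset measurable_sets[OF Xm])
  then interpret F: finite_measure_subalgebra M ?F
    by unfold_locales (simp add: subalgebra_def natural_filtration_def space_measure_of_conv)
  have int: "integrable M (\<lambda>\<omega>. indicator C (X t \<omega>) :: real)"
    using Xm[OF t] by (intro integrable_const_bound[where B=1]) auto
  have "measure M (X t -` C \<inter> space M) = measure (distr M E (X t)) C"
    using Xm[OF t] C by (simp add: measure_distr)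
  also have "\<dots> = (\<integral>y. indicator C y \<partial>distr M E (X t))"
    using sets.sets_into_space[OF C] by (simp add: Int_absorb2)
  also have "\<dots> = (\<integral>\<omega>. indicator C (X t \<omega>) \<partial>M)"
    using Xm[OF t] by (subst integral_distr) auto
  also have "\<dots> = (\<integral>\<omega>. real_cond_exp M ?F (\<lambda>\<omega>. indicator C (X t \<omega>)) \<omega> \<partial>M)"
    using F.real_cond_exp_int(2)[OF int] by simp
  also have "\<dots> = (\<integral>\<omega>. measure (P t x) C \<partial>M)"
  proof (rule integral_cong_AE)
    have "AE \<omega> in M. real_cond_exp M ?F (\<lambda>\<omega>'. indicator C (X (0 + t) \<omega>')) \<omega> = measure (P t (X 0 \<omega>)) C"
      using mp t C unfolding markov_process_def by blast
    then show "AE \<omega> in M. real_cond_exp M ?F (\<lambda>\<omega>'. indicator C (X t \<omega>')) \<omega> = measure (P t x) C"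
      using init by eventually_elim simp
  qed (use F.real_cond_exp_int(1)[OF int] in auto)
  finally have "measure M (X t -` C \<inter> space M) = measure (P t x) C"
    by (simp add: prob_space)
  then show "emeasure (distr M E (X t)) C = emeasure (P t x) C"
    using Xm[OF t] C by (simp add: emeasure_distr emeasure_eq_measure Px.emeasure_eq_measure)
qed

text \<open>It serves to exchange rates truncated at 0 for the given ones: the generator is
  evaluated only at states in \<open>E\<close>, where both agree.\<close>

lemma markov_jump_process_cong:
  assumes "\<And>\<phi> z. z \<in> E \<Longrightarrow> B \<phi> z = B' \<phi> z" and "markov_jump_process M E B Y"
  shows "markov_jump_process M E B' Y"
  using assms unfolding markov_jump_process_def by simp

section \<open>Duality\<close>

theorem lemma2p1:
  fixes S :: "real set"
    and w :: "real \<Rightarrow> real"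
    and P :: "real \<Rightarrow> real \<Rightarrow> real measure"
    and D :: "(real \<Rightarrow> real) set"
    and A :: "(real \<Rightarrow> real) \<Rightarrow> real \<Rightarrow> real"
    and M :: "real \<Rightarrow> 'o measure"
    and X :: "real \<Rightarrow> real \<Rightarrow> 'o \<Rightarrow> real"
    and \<mu> :: "real measure"
    and N :: "'p measure"
    and Z :: "'p \<Rightarrow> real"
    and a b :: "nat \<Rightarrow> nat \<Rightarrow> real"
    and k :: nat
    and x :: real
  assumes interval: "is_interval S"
    and feller: "feller_semigroup S w P"
    and generator: "is_generator S w P D A"
    and diffusion: "\<And>y. y \<in> S \<Longrightarrow> diffusion_from (M y) S P (X y) y"
    and stationary: "unique_stationary_distribution (restrict_space borel S) P \<mu>"
    and Z: "prob_space N" "Z \<in> N \<rightarrow>\<^sub>M restrict_space borel S"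
           "distr N (restrict_space borel S) Z = \<mu>"
    and k: "k \<ge> 1"
    and domain: "\<And>j. j \<in> {1..k} \<Longrightarrow> (\<lambda>y. y ^ j) \<in> D"
    and rates: "\<And>j i. j \<in> {1..k} \<Longrightarrow> i \<in> {1..j} \<Longrightarrow> a j i \<ge> 0"
    and action: "\<And>j y. j \<in> {1..k} \<Longrightarrow> y \<in> S \<Longrightarrow>
                   A (\<lambda>y. y ^ j) y = (\<Sum>i=1..j. a j i * (b j i * y ^ (j - i) - y ^ j))"
    and x: "x \<in> S"
  shows "\<exists>(M' :: (nat \<Rightarrow> real) measure) (Y :: real \<Rightarrow> (nat \<Rightarrow> real) \<Rightarrow> real \<times> nat).
           markov_jump_process M' (mono_states k) (dual_generator a b) Y \<and>
           (\<forall>\<omega>\<in>space M'. Y 0 \<omega> = (1, k)) \<and>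
           (\<forall>t>0. integrable (M x) (\<lambda>\<omega>. X x t \<omega> ^ k) \<and>
                  integrable M' (\<lambda>\<omega>. mono_val x (Y t \<omega>)) \<and>
                  (\<integral>\<omega>. X x t \<omega> ^ k \<partial>M x) = (\<integral>\<omega>. mono_val x (Y t \<omega>) \<partial>M')) \<and>
           (\<forall>f. integrable N (\<lambda>\<omega>. Z \<omega> ^ k) \<and>
                stein_solution S D A M X (\<lambda>y. y ^ k) (\<integral>\<omega>. Z \<omega> ^ k \<partial>N) f \<longrightarrow>
                set_integrable lborel {0..}
                  (\<lambda>t. (\<integral>\<omega>. mono_val x (Y t \<omega>) \<partial>M') - (\<integral>\<omega>. Z \<omega> ^ k \<partial>N)) \<and>
                f x = - (LINT t:{0..}|lborel.
                          (\<integral>\<omega>. mono_val x (Y t \<omega>) \<partial>M') - (\<integral>\<omega>. Z \<omega> ^ k \<partial>N)))"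
proof -
  interpret W: weighted_feller S w P using feller by unfold_locales
  \<comment> \<open>Only the rates at degrees up to \<open>k\<close> are assumed nonnegative; the others are irrelevant.\<close>
  interpret J: dual_jump "\<lambda>j i. max 0 (a j i)" b by unfold_locales simp
  have start: "(1, k) \<in> mono_states k" by (simp add: mono_states_def)
  have jump: "markov_jump_process J.\<Omega> (mono_states k) (dual_generator a b) (\<lambda>t \<omega>. J.path (1, k) \<omega> t)"
  proof (rule markov_jump_process_cong[OF _ J.markov_jump_process_path[OF start]])
    fix \<phi> and z :: "real \<times> nat" assume "z \<in> mono_states k"
    then show "dual_generator (\<lambda>j i. max 0 (a j i)) b \<phi> z = dual_generator a b \<phi> z"
      using rates by (cases z) (auto simp: dual_generator_def mono_states_def intro!: sum.cong)
  qed
  have mean: "J.path_mean (mono_val x) (1, k) t = semigroup_op P t (\<lambda>y. y ^ k) x" if t: "0 \<le> t" for t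
  proof -
    have "J.path_mean (mono_val x) (1, k) t = 1 * semigroup_op P t (\<lambda>y. y ^ k) x"
    \<comment> \<open>The moments of all degrees up to \<open>k\<close>, degree 0 included, play the
      role of \<open>u\<close>; the starting coefficient is 1.\<close>
    proof (rule J.path_mean_mono_val[of k "\<lambda>j t. semigroup_op P t (\<lambda>y. y ^ j) x"])
      fix j and t :: real assume j: "j \<le> k" and t: "0 \<le> t"
      have "A (\<lambda>y. y ^ j) y = (\<Sum>i=1..j. max 0 (a j i) * (b j i * y ^ (j - i) - y ^ j))" if "1 \<le> j" "y \<in> S" for y
        using action[of j y] rates[of j] that j by simp
      then show "((\<lambda>t. semigroup_op P t (\<lambda>y. y ^ j) x) has_real_derivative
          (\<Sum>i=1..j. max 0 (a j i) * (b j i * semigroup_op P t (\<lambda>y. y ^ (j - i)) x - semigroup_op P t (\<lambda>y. y ^ j) x)))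
          (at t within {0..})"
        using j domain by (intro W.moment_deriv[OF generator _ _ x t]) auto
    next
      fix j assume "j \<le> k"
      have "P 0 x = return W.E x"
        using W.transition_semigroup x by (simp add: transition_semigroup_def)
      moreover have "(\<lambda>y. y ^ j) \<in> borel_measurable W.E"
        by (intro borel_measurable_continuous_on_restrict continuous_intros)
      ultimately show "semigroup_op P 0 (\<lambda>y. y ^ j) x = x ^ j"
        using x by (simp add: semigroup_op_def integral_return)
    qed (use t in auto)
    then show ?thesis by simp
  qed
  \<comment> \<open>Identifying the law of \<open>X x t\<close> with \<open>P t x\<close> ties the
    kernel integrals to the given process; integrability comes from \<open>y ^ k\<close> lying in
    the weighted space.\<close>
  have diff: "integrable (M x) (\<lambda>\<omega>. X x t \<omega> ^ k)" "(\<integral>\<omega>. X x t \<omega> ^ k \<partial>M x) = semigroup_op P t (\<lambda>y. y ^ k) x"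
    if t: "0 \<le> t" for t
  proof -
    have mp: "markov_process (M x) W.E P (X x)" "AE \<omega> in M x. X x 0 \<omega> = x"
      using diffusion[OF x] by (auto simp: diffusion_from_def)
    have law: "distr (M x) W.E (X x t) = P t x"
      using x by (intro distr_markov_process[OF mp _ t W.measurable_kernel[OF t]]) simp
    have Xm: "X x t \<in> measurable (M x) W.E"
      using mp(1) t by (simp add: markov_process_def)
    have C0: "(\<lambda>y. y ^ k) \<in> weighted_C0 S w"
      using is_generator_graph[OF generator domain[of k]] k by (simp add: generator_graph_def)
    note m = W.measurable_C0[OF C0]
    show "integrable (M x) (\<lambda>\<omega>. X x t \<omega> ^ k)"
      using W.integrable_C0[OF t x C0] integrable_distr_eq[OF Xm m] by (simp add: law)
    show "(\<integral>\<omega>. X x t \<omega> ^ k \<partial>M x) = semigroup_op P t (\<lambda>y. y ^ k) x"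
      using integral_distr[OF Xm m] by (simp add: law semigroup_op_def)
  qed
  have dual: "(\<integral>\<omega>. X x t \<omega> ^ k \<partial>M x) = (\<integral>\<omega>. mono_val x (J.path (1, k) \<omega> t) \<partial>J.\<Omega>)" if "0 \<le> t" for t
    using mean[OF that] diff(2)[OF that] by (simp add: J.path_mean_def)
  show ?thesis
  proof (intro exI[of _ J.\<Omega>] exI[of _ "\<lambda>t \<omega>. J.path (1, k) \<omega> t"] conjI allI impI ballI)
    show "markov_jump_process J.\<Omega> (mono_states k) (dual_generator a b) (\<lambda>t \<omega>. J.path (1, k) \<omega> t)"
      by (rule jump)
    show "J.path (1, k) \<omega> 0 = (1, k)" for \<omega>
      by (simp add: J.path_nonpos)
    show "integrable J.\<Omega> (\<lambda>\<omega>. mono_val x (J.path (1, k) \<omega> t))" for t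
      by (rule J.integrable_path)
    fix t :: real assume "0 < t"
    then show "integrable (M x) (\<lambda>\<omega>. X x t \<omega> ^ k)"
      and "(\<integral>\<omega>. X x t \<omega> ^ k \<partial>M x) = (\<integral>\<omega>. mono_val x (J.path (1, k) \<omega> t) \<partial>J.\<Omega>)"
      using diff(1) dual by auto
  next
    fix f
    let ?c = "\<integral>\<omega>. Z \<omega> ^ k \<partial>N"
    assume "integrable N (\<lambda>\<omega>. Z \<omega> ^ k) \<and> stein_solution S D A M X (\<lambda>y. y ^ k) ?c f"
    \<comment> \<open>\<open>stein_solution\<close> fixes \<open>f x\<close> as the semigroup
      integral and includes its convergence. Duality holds at every \<open>t \<ge> 0\<close>, so the
      integrands agree on the whole half-line.\<close>
    then have sol: "set_integrable lborel {0..} (\<lambda>t. (\<integral>\<omega>. X x t \<omega> ^ k \<partial>M x) - ?c)"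
      "f x = - (LINT t:{0..}|lborel. (\<integral>\<omega>. X x t \<omega> ^ k \<partial>M x) - ?c)"
      using x by (auto simp: stein_solution_def)
    show "set_integrable lborel {0..} (\<lambda>t. (\<integral>\<omega>. mono_val x (J.path (1, k) \<omega> t) \<partial>J.\<Omega>) - ?c)"
      using sol(1) by (rule set_integrable_cong[THEN iffD1, rotated 3]) (simp_all add: dual)
    show "f x = - (LINT t:{0..}|lborel. (\<integral>\<omega>. mono_val x (J.path (1, k) \<omega> t) \<partial>J.\<Omega>) - ?c)"
      unfolding sol(2) by (intro arg_cong[where f=uminus] set_lebesgue_integral_cong) (simp_all add: dual)
  qed
qed

end
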